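(* Let $E$ be a finitely generated graded $R$-module and let $1\le\rho<r$ be an integer. Suppose $\Gamma$ is chosen sufficiently generally and that $E$ has a minimal free resolution $$\cdots\longrightarrow\bigoplus_{i=1}^{Q'}R^\star(-\kappa'_i)\xrightarrow{\ \Phi\ }\bigoplus_{i=1}^{Q}R^\star(\kappa_i)\xrightarrow{\ \pi\ }E\longrightarrow0$$ over $R^\star:=k[x_{\rho+1},\ldots,x_r]$ with homogeneous homomorphisms $\Phi,\pi$ of degree zero, where $\kappa_1\le\cdots\le\kappa_Q$ and $\kappa'_1\le\cdots\le\kappa'_{Q'}$. For $1\le j\le\rho$ let $X_j$ be a $Q\times Q$ matrix with entries in $R^\star$ giving a homogeneous homomorphism $X_j:\bigoplus_{i=1}^{Q}R^\star(\kappa_i-1)\to\bigoplus_{i=1}^{Q}R^\star(\kappa_i)$ of degree zero which represents the multiplication map $\times x_j:E(-1)\to E$, i.e. $\pi(X_jv)=x_j\pi(v)$ for all $v$. Let $p$ be an integer with $1\le p<Q$ and $\kappa_p<\kappa_{p+1}$, let $s_2,\ldots,s_\rho\in k$ be arbitrary, and put $W:=X_1+\sum_{j=2}^{\rho}s_jX_j$. Then $$W^{\nu}\,[\operatorname{Im}(\Phi)]_{\le-\kappa_p}\subset N_p\qquad\text{for all integers }\nu\ge0 .$$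
   Context: $k$ is an infinite field, $R=k[y_1,\ldots,y_r]$ with the standard grading, $\Gamma=(\gamma_{ij})\in GL_r(k)$, and $x_1,\ldots,x_r$ are the linear forms of $R$ with $y_i=\sum_{j=1}^{r}\gamma_{ji}x_j$ for $1\le i\le r$. "$\Gamma$ is chosen sufficiently generally" means that $\Gamma$ lies in a suitable nonempty Zariski open subset of $GL_r(k)$ depending on $E$ (and $\rho$). $[M]_d$ is the degree $d$ part of a graded module $M$, $[M]_{\le d}:=\sum_{d'\le d}[M]_{d'}$, and $M(a)$ is the shift $[M(a)]_d=[M]_{a+d}$. $N_p:=0^p\oplus\bigoplus_{i=p+1}^{Q}R^\star(\kappa_i)$ is the $R^\star$-submodule of $\bigoplus_{i=1}^{Q}R^\star(\kappa_i)$ consisting of all elements whose first $p$ components are zero. Elements of $\bigoplus_{i=1}^{Q}R^\star(\kappa_i)$ are regarded as column vectors, on which $Q\times Q$ matrices over $R^\star$ act from the left. *)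

theory Defs
  imports
    "HOL-Library.Poly_Mapping"
    "Jordan_Normal_Form.Matrix"
begin

text \<open>
  All families that are numbered from 1 in the mathematical text (the variables, the linear forms,
  the generators of a free module, rows and columns of matrices) are numbered from 0 here, as in
  the matrix library.
\<close>

text \<open>
  The polynomial ring over \<open>'k\<close> in variables indexed by \<open>'v\<close>: monomials are finitely supported
  exponent functions. For \<open>'v\<close> finite with r elements this is the ring of polynomials in r variables.
\<close>

type_synonym ('v, 'k) mpoly = "('v \<Rightarrow>\<^sub>0 nat) \<Rightarrow>\<^sub>0 'k"

definition Const :: "'k::zero \<Rightarrow> ('v, 'k) mpoly" where
  "Const c = Poly_Mapping.single 0 c"

definition Var :: "'v \<Rightarrow> ('v, 'k::zero_neq_one) mpoly" where
  "Var v = Poly_Mapping.single (Poly_Mapping.single v 1) 1"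

definition eval_mpoly :: "('v \<Rightarrow> 'k) \<Rightarrow> ('v, 'k::comm_semiring_1) mpoly \<Rightarrow> 'k" where
  "eval_mpoly a f = (\<Sum>m\<in>Poly_Mapping.keys f. Poly_Mapping.lookup f m * (\<Prod>v\<in>Poly_Mapping.keys m. a v ^ Poly_Mapping.lookup m v))"

text \<open>This consists of the zero polynomial only if d is negative.\<close>

definition homog :: "int \<Rightarrow> ('v, 'k::zero) mpoly set" where
  "homog d = {f. \<forall>m\<in>Poly_Mapping.keys f. int (\<Sum>v\<in>Poly_Mapping.keys m. Poly_Mapping.lookup m v) = d}"

inductive_set adjoin :: "('v, 'k::comm_ring_1) mpoly set \<Rightarrow> ('v, 'k) mpoly set"
  for G :: "('v, 'k) mpoly set" where
  const: "Const c \<in> adjoin G"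
| gen: "g \<in> G \<Longrightarrow> g \<in> adjoin G"
| add: "f \<in> adjoin G \<Longrightarrow> g \<in> adjoin G \<Longrightarrow> f + g \<in> adjoin G"
| mult: "f \<in> adjoin G \<Longrightarrow> g \<in> adjoin G \<Longrightarrow> f * g \<in> adjoin G"

text \<open>
  The linear forms \<open>x\<^sub>j\<close> determined by \<open>y\<^sub>i = (\<Sum>j<r. \<gamma>\<^sub>j\<^sub>i x\<^sub>j)\<close>; here y lists
  the variables of the polynomial ring.
\<close>

definition new_coordinates ::
  "nat \<Rightarrow> (nat \<Rightarrow> 'v) \<Rightarrow> 'k::comm_ring_1 mat \<Rightarrow> (nat \<Rightarrow> ('v, 'k) mpoly) \<Rightarrow> bool" where
  "new_coordinates r y \<Gamma> x \<longleftrightarrow>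
     (\<forall>j<r. x j \<in> homog 1) \<and>
     (\<forall>i<r. Var (y i) = (\<Sum>j<r. Const (\<Gamma> $$ (j, i)) * x j))"

definition GL :: "nat \<Rightarrow> 'k::field mat set" where
  "GL r = {\<Gamma> \<in> carrier_mat r r. invertible_mat \<Gamma>}"

text \<open>
  Zariski open subsets of the general linear group: complements of common zero sets of polynomials
  in the matrix entries. The inverse determinant may be omitted, since it is a unit there. Only
  entries inside the matrix may occur, as others have no mathematical meaning.
\<close>

definition zariski_open_GL :: "nat \<Rightarrow> 'k::field mat set \<Rightarrow> bool" where
  "zariski_open_GL r U \<longleftrightarrow>
     (\<exists>P :: (nat \<times> nat, 'k) mpoly set.
        (\<forall>f\<in>P. \<forall>m\<in>Poly_Mapping.keys f. Poly_Mapping.keys m \<subseteq> {..<r} \<times> {..<r}) \<and>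
        U = {\<Gamma> \<in> GL r. \<exists>f\<in>P. eval_mpoly (\<lambda>ij. \<Gamma> $$ ij) f \<noteq> 0})"

definition graded_module ::
  "(('v, 'k::field) mpoly \<Rightarrow> 'e::ab_group_add \<Rightarrow> 'e) \<Rightarrow> (int \<Rightarrow> 'e set) \<Rightarrow> bool" where
  "graded_module scale gr \<longleftrightarrow>
     Modules.module scale \<and>
     (\<forall>d. 0 \<in> gr d \<and> (\<forall>u\<in>gr d. \<forall>v\<in>gr d. u - v \<in> gr d)) \<and>
     (\<forall>a d. \<forall>f\<in>homog a. \<forall>u\<in>gr d. scale f u \<in> gr (a + d)) \<and>
     (\<forall>u. \<exists>!c. finite {d. c d \<noteq> 0} \<and> (\<forall>d. c d \<in> gr d) \<and> u = (\<Sum>d | c d \<noteq> 0. c d))"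

definition finitely_generated ::
  "('a::comm_ring_1 \<Rightarrow> 'e::ab_group_add \<Rightarrow> 'e) \<Rightarrow> bool" where
  "finitely_generated scale \<longleftrightarrow> (\<exists>B. finite B \<and> Modules.module.span scale B = UNIV)"

text \<open>
  In what follows, A stands for a subalgebra generated by linear forms. The graded free module
  \<open>\<Oplus>\<^sub>i\<^sub><\<^sub>n A(\<kappa>\<^sub>i)\<close> consists of the vectors of dimension n over A; its degree d part has in
  position i the elements of A of degree \<open>d + \<kappa>\<^sub>i\<close>.
\<close>

definition free_mod :: "('v, 'k::field) mpoly set \<Rightarrow> nat \<Rightarrow> ('v, 'k) mpoly vec set" where
  "free_mod A n = {v \<in> carrier_vec n. \<forall>i<n. v $ i \<in> A}"

definition free_deg ::
  "('v, 'k::field) mpoly set \<Rightarrow> nat \<Rightarrow> (nat \<Rightarrow> int) \<Rightarrow> int \<Rightarrow> ('v, 'k) mpoly vec set" where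
  "free_deg A n \<kappa> d = {v \<in> free_mod A n. \<forall>i<n. v $ i \<in> homog (d + \<kappa> i)}"

text \<open>\<open>[M]\<^sub>\<le>\<^sub>d\<close> for a graded submodule M of a graded free module.\<close>

definition part_le ::
  "('v, 'k::field) mpoly set \<Rightarrow> nat \<Rightarrow> (nat \<Rightarrow> int) \<Rightarrow> ('v, 'k) mpoly vec set \<Rightarrow> int
    \<Rightarrow> ('v, 'k) mpoly vec set" where
  "part_le A n \<kappa> M d =
     {finsum_vec TYPE(('v, 'k) mpoly) n c D | c D.
        finite D \<and> D \<subseteq> {..d} \<and> (\<forall>d'\<in>D. c d' \<in> M \<inter> free_deg A n \<kappa> d')}"

definition first_zero :: "('v, 'k::field) mpoly set \<Rightarrow> nat \<Rightarrow> nat \<Rightarrow> ('v, 'k) mpoly vec set" where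
  "first_zero A n p = {v \<in> free_mod A n. \<forall>i<p. v $ i = 0}"

text \<open>
  Homogeneous A-linear maps of degree zero from a graded free module to another one, and from a
  graded free module to a graded module over the whole polynomial ring, regarded as an A-module.
\<close>

definition free_hom ::
  "('v, 'k::field) mpoly set \<Rightarrow> nat \<Rightarrow> (nat \<Rightarrow> int) \<Rightarrow> nat \<Rightarrow> (nat \<Rightarrow> int)
    \<Rightarrow> (('v, 'k) mpoly vec \<Rightarrow> ('v, 'k) mpoly vec) \<Rightarrow> bool" where
  "free_hom A m \<kappa> n \<mu> \<phi> \<longleftrightarrow>
     (\<forall>u\<in>free_mod A m. \<phi> u \<in> free_mod A n) \<and>
     (\<forall>u\<in>free_mod A m. \<forall>v\<in>free_mod A m. \<phi> (u + v) = \<phi> u + \<phi> v) \<and>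
     (\<forall>a\<in>A. \<forall>u\<in>free_mod A m. \<phi> (a \<cdot>\<^sub>v u) = a \<cdot>\<^sub>v \<phi> u) \<and>
     (\<forall>d. \<forall>u\<in>free_deg A m \<kappa> d. \<phi> u \<in> free_deg A n \<mu> d)"

definition module_hom_from_free ::
  "(('v, 'k::field) mpoly \<Rightarrow> 'e::ab_group_add \<Rightarrow> 'e) \<Rightarrow> (int \<Rightarrow> 'e set)
    \<Rightarrow> ('v, 'k) mpoly set \<Rightarrow> nat \<Rightarrow> (nat \<Rightarrow> int) \<Rightarrow> (('v, 'k) mpoly vec \<Rightarrow> 'e) \<Rightarrow> bool" where
  "module_hom_from_free scale gr A m \<kappa> \<pi> \<longleftrightarrow>
     (\<forall>u\<in>free_mod A m. \<forall>v\<in>free_mod A m. \<pi> (u + v) = \<pi> u + \<pi> v) \<and>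
     (\<forall>a\<in>A. \<forall>u\<in>free_mod A m. \<pi> (a \<cdot>\<^sub>v u) = scale a (\<pi> u)) \<and>
     (\<forall>d. \<forall>u\<in>free_deg A m \<kappa> d. \<pi> u \<in> gr d)"

text \<open>
  Minimal free resolutions
  \<open>\<dots> \<rightarrow> F\<^sub>2 \<rightarrow> F\<^sub>1 \<rightarrow> F\<^sub>0 \<rightarrow> E \<rightarrow> 0\<close> over A with
  \<open>F\<^sub>n\<close> the direct sum of the \<open>A(tw n i)\<close>, \<open>i < rk n\<close>, and boundary maps \<open>\<delta> n : F\<^sub>n\<^sub>+\<^sub>1 \<rightarrow> F\<^sub>n\<close>. Minimality
  means that the image of each boundary map lies in the product of its target with the irrelevant
  maximal ideal of A, i.e. the ideal of the elements of A without constant term.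
\<close>

definition minimal_free_resolution ::
  "(('v, 'k::field) mpoly \<Rightarrow> 'e::ab_group_add \<Rightarrow> 'e) \<Rightarrow> (int \<Rightarrow> 'e set)
    \<Rightarrow> ('v, 'k) mpoly set \<Rightarrow> (nat \<Rightarrow> nat) \<Rightarrow> (nat \<Rightarrow> nat \<Rightarrow> int)
    \<Rightarrow> (nat \<Rightarrow> ('v, 'k) mpoly vec \<Rightarrow> ('v, 'k) mpoly vec)
    \<Rightarrow> (('v, 'k) mpoly vec \<Rightarrow> 'e) \<Rightarrow> bool" where
  "minimal_free_resolution scale gr A rk tw \<delta> \<pi> \<longleftrightarrow>
     module_hom_from_free scale gr A (rk 0) (tw 0) \<pi> \<and>
     (\<forall>n. free_hom A (rk (Suc n)) (tw (Suc n)) (rk n) (tw n) (\<delta> n)) \<and>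
     \<pi> ` free_mod A (rk 0) = UNIV \<and>
     {u \<in> free_mod A (rk 0). \<pi> u = 0} = \<delta> 0 ` free_mod A (rk 1) \<and>
     (\<forall>n. {u \<in> free_mod A (rk (Suc n)). \<delta> n u = 0\<^sub>v (rk n)}
            = \<delta> (Suc n) ` free_mod A (rk (Suc (Suc n)))) \<and>
     (\<forall>n. \<forall>u\<in>free_mod A (rk (Suc n)). \<forall>i<rk n. Poly_Mapping.lookup (\<delta> n u $ i) 0 = 0)"

definition lin_comb_mat ::
  "nat \<Rightarrow> nat \<Rightarrow> (nat \<Rightarrow> ('v, 'k::field) mpoly mat) \<Rightarrow> (nat \<Rightarrow> 'k) \<Rightarrow> ('v, 'k) mpoly mat" where
  "lin_comb_mat Q \<rho> X s =
     mat Q Q (\<lambda>ab. X 0 $$ ab + (\<Sum>j\<in>{1..<\<rho>}. Const (s j) * X j $$ ab))"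

end

theory Submission
  imports Defs "HOL-Computational_Algebra.Polynomial" "Jordan_Normal_Form.Determinant"
begin

text \<open>
  Variables and generators are numbered from 0, and \<open>L\<close> denotes the span of the forms
  \<open>x\<^sub>l\<close> with \<open>\<rho> \<le> l < r\<close>.

  Let \<open>d \<le> - \<kappa> (p - 1)\<close>. In the first p positions the entries of a vector of degree \<open>d\<close> have degree
  at most 0, and those of a vector of degree \<open>d - 1\<close> have negative degree. Hence the free module has
  only zeros there in degree \<open>d - 1\<close>, and by minimality so has every relation (element of the kernel
  of \<open>\<pi>\<close>) of degree \<open>d\<close>. This is the case \<open>\<nu> = 0\<close>; the difficulty is that \<open>W\<^sup>\<nu>\<close> raises the
  degree beyond this range.

  A relation \<open>u\<close> of degree \<open>d\<close> can be written as \<open>u = \<Sum>\<^sub>l x\<^sub>l w\<^sub>l\<close> with \<open>w\<^sub>l\<close> of degree \<open>d - 1\<close>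
  (\<open>relation_split\<close>), so that \<open>(\<pi> w\<^sub>l)\<^sub>l\<close> lies in the kernel of the k-linear map
  \<open>(f\<^sub>l)\<^sub>l \<mapsto> \<Sum>\<^sub>l x\<^sub>l f\<^sub>l\<close> on tuples from the degree \<open>d - 1\<close> part of \<open>E\<close>. In generic coordinates the rank
  of this map is the largest one that occurs in any coordinates. In particular it does not grow when
  \<open>x\<^sub>l\<close> is replaced by \<open>x\<^sub>l - z \<tau>\<^sub>l b\<close>, where \<open>b = x\<^sub>0 + \<Sum>\<^sub>j s\<^sub>j x\<^sub>j\<close> and the scalars \<open>\<tau>\<^sub>l\<close>, \<open>z\<close> are
  arbitrary, and therefore each kernel element extends to a formal power series \<open>\<Sum>\<^sub>k z\<^sup>k F\<^sub>k\<close> in the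
  kernel of the perturbed map (\<open>kernel_lifts_of_maximal_rank\<close>). Comparing coefficients,
  \<open>\<Sum>\<^sub>l x\<^sub>l F\<^sub>k\<^sub>+\<^sub>1\<^sub>,\<^sub>l = b \<Sum>\<^sub>l \<tau>\<^sub>l F\<^sub>k\<^sub>,\<^sub>l\<close> for all \<open>k\<close>.

  Now fix a point \<open>a\<close> of affine space and take \<open>\<tau>\<^sub>l = x\<^sub>l(a)\<close>. Choose preimages \<open>v\<^sub>k\<^sub>,\<^sub>l\<close> of the
  \<open>F\<^sub>k\<^sub>,\<^sub>l\<close> in degree \<open>d - 1\<close>, with \<open>v\<^sub>0\<^sub>,\<^sub>l = w\<^sub>l\<close>, and put \<open>q\<^sub>k = \<Sum>\<^sub>l \<tau>\<^sub>l v\<^sub>k\<^sub>,\<^sub>l\<close>. Then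
  \<open>h\<^sub>k = W q\<^sub>k - \<Sum>\<^sub>l x\<^sub>l v\<^sub>k\<^sub>+\<^sub>1\<^sub>,\<^sub>l\<close> is again a relation of degree \<open>d\<close>, and as the sum
  \<open>\<Sum>\<^sub>l x\<^sub>l v\<^sub>k\<^sub>+\<^sub>1\<^sub>,\<^sub>l\<close> takes at \<open>a\<close> the same value as \<open>q\<^sub>k\<^sub>+\<^sub>1\<close>, evaluation gives
  \<open>W(a) q\<^sub>k(a) = q\<^sub>k\<^sub>+\<^sub>1(a) + h\<^sub>k(a)\<close> and \<open>u(a) = q\<^sub>0(a)\<close> (\<open>lift_sequence_exists\<close>). So
  \<open>W(a)\<^sup>\<nu>\<close> applied to \<open>u(a)\<close> is reduced to vectors \<open>q\<^sub>k(a)\<close> and \<open>h\<^sub>k(a)\<close> and smaller powers,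
  and an induction on \<open>\<nu>\<close> shows that the first p entries of \<open>W\<^sup>\<nu> u\<close> vanish at \<open>a\<close>
  (\<open>eval_pow_first_zero\<close>). As \<open>a\<close> is arbitrary and the field is infinite, they vanish. Working with values
  at points instead of derivatives makes the argument independent of the characteristic.

  It remains to see that a nonempty open set of coordinates has maximal rank in all degrees. In a single
  degree, maximal rank is guaranteed by a nonzero minor, which is a polynomial in the entries of
  \<open>\<Gamma>\<close> (\<open>generic_rank\<close>), and finitely many such polynomials have a common nonzero
  (\<open>polyfun_common_nonzero\<close>). Finitely many degrees suffice: if some coordinates admit a resolution at
  all, then \<open>E\<close> vanishes below the degrees of its finitely many generators, while from some degree on
  each graded part of \<open>E\<close> is \<open>L\<close> times the preceding one, a property that maximal rank in one degree
  carries over to generic coordinates (\<open>generates_next_if_rank\<close>, \<open>generates_next_propagates\<close>). If no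
  coordinates admit a resolution, there is nothing to prove.
\<close>

section \<open>Evaluation of polynomials\<close>

definition monomial_value :: "('v \<Rightarrow> 'k::comm_semiring_1) \<Rightarrow> ('v \<Rightarrow>\<^sub>0 nat) \<Rightarrow> 'k" where
  "monomial_value a m = (\<Prod>v\<in>Poly_Mapping.keys m. a v ^ Poly_Mapping.lookup m v)"

lemma monomial_value_superset:
  assumes "finite S" "Poly_Mapping.keys m \<subseteq> S"
  shows "monomial_value a m = (\<Prod>v\<in>S. a v ^ Poly_Mapping.lookup m v)"
  unfolding monomial_value_def
  using assms by (intro prod.mono_neutral_left) (auto simp: in_keys_iff)

lemma monomial_value_add: "monomial_value a (m + n) = monomial_value a m * monomial_value a n"
proof -
  let ?S = "Poly_Mapping.keys m \<union> Poly_Mapping.keys n"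
  have "Poly_Mapping.keys (m + n) \<subseteq> ?S" by (rule keys_add)
  then show ?thesis
    using monomial_value_superset[of ?S "m + n" a] monomial_value_superset[of ?S m a]
      monomial_value_superset[of ?S n a]
    by (simp add: lookup_add power_add prod.distrib)
qed

lemma monomial_value_0 [simp]: "monomial_value a 0 = 1"
  by (simp add: monomial_value_def)

lemma eval_mpoly_superset:
  assumes "finite S" "Poly_Mapping.keys f \<subseteq> S"
  shows "eval_mpoly a f = (\<Sum>m\<in>S. Poly_Mapping.lookup f m * monomial_value a m)"
  unfolding eval_mpoly_def monomial_value_def
  using assms by (intro sum.mono_neutral_left) (auto simp: in_keys_iff)

lemma eval_mpoly_0 [simp]: "eval_mpoly a 0 = 0"
  by (simp add: eval_mpoly_def)

lemma eval_mpoly_single [simp]: "eval_mpoly a (Poly_Mapping.single m c) = c * monomial_value a m"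
  by (subst eval_mpoly_superset[of "{m}"]) auto

lemma eval_mpoly_1 [simp]: "eval_mpoly a 1 = 1"
  by (metis eval_mpoly_single monomial_value_0 mult_1 single_one)

lemma eval_mpoly_Const [simp]: "eval_mpoly a (Const c) = c"
  by (simp add: Const_def)

lemma eval_mpoly_Var [simp]: "eval_mpoly a (Var v) = a v"
  by (simp add: Var_def monomial_value_def)

lemma eval_mpoly_add [simp]: "eval_mpoly a (f + g) = eval_mpoly a f + eval_mpoly a g"
proof -
  let ?S = "Poly_Mapping.keys f \<union> Poly_Mapping.keys g"
  have "Poly_Mapping.keys (f + g) \<subseteq> ?S" by (rule keys_add)
  then show ?thesis
    using eval_mpoly_superset[of ?S "f + g" a] eval_mpoly_superset[of ?S f a]
      eval_mpoly_superset[of ?S g a]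
    by (simp add: lookup_add algebra_simps sum.distrib)
qed

lemma eval_mpoly_sum [simp]: "eval_mpoly a (sum f S) = (\<Sum>i\<in>S. eval_mpoly a (f i))"
  by (induction S rule: infinite_finite_induct) auto

lemma mpoly_sum_singles:
  "f = (\<Sum>m\<in>Poly_Mapping.keys f. Poly_Mapping.single m (Poly_Mapping.lookup f m))"
  by (rule poly_mapping_eqI) (auto simp: lookup_sum lookup_single when_def in_keys_iff)

lemma eval_mpoly_mult [simp]:
  "eval_mpoly a (f * g) = eval_mpoly a f * eval_mpoly a g"
proof -
  have 1: "eval_mpoly a (Poly_Mapping.single m c * g) = c * monomial_value a m * eval_mpoly a g" for m c
  proof -
    have "Poly_Mapping.single m c * g = (\<Sum>n\<in>Poly_Mapping.keys g.
        Poly_Mapping.single m c * Poly_Mapping.single n (Poly_Mapping.lookup g n))"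
      unfolding sum_distrib_left[symmetric] by (simp flip: mpoly_sum_singles)
    then have "eval_mpoly a (Poly_Mapping.single m c * g) =
        (\<Sum>n\<in>Poly_Mapping.keys g. c * Poly_Mapping.lookup g n * (monomial_value a m * monomial_value a n))"
      by (simp add: mult_single monomial_value_add)
    also have "\<dots> = c * monomial_value a m * eval_mpoly a g"
      by (simp add: eval_mpoly_superset[of "Poly_Mapping.keys g" g] sum_distrib_left mult_ac)
    finally show ?thesis .
  qed
  have "f * g = (\<Sum>n\<in>Poly_Mapping.keys f. Poly_Mapping.single n (Poly_Mapping.lookup f n) * g)"
    unfolding sum_distrib_right[symmetric] by (simp flip: mpoly_sum_singles)
  then have "eval_mpoly a (f * g) =
      (\<Sum>n\<in>Poly_Mapping.keys f. Poly_Mapping.lookup f n * monomial_value a n * eval_mpoly a g)"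
    by (simp add: 1)
  also have "\<dots> = eval_mpoly a f * eval_mpoly a g"
    by (simp add: eval_mpoly_superset[of "Poly_Mapping.keys f" f] sum_distrib_right)
  finally show ?thesis .
qed

lemma infinite_power_eq_imp_eq:
  assumes "infinite (UNIV :: 'k::field set)" "\<And>z::'k. z ^ i = z ^ j"
  shows "i = j"
proof (rule ccontr)
  assume "i \<noteq> j"
  let ?p = "monom (1::'k) i - monom 1 j"
  have "coeff ?p i \<noteq> coeff 0 i" using \<open>i \<noteq> j\<close> by simp
  then have "?p \<noteq> 0" by metis
  then have "finite {z. poly ?p z = 0}" by (rule poly_roots_finite)
  moreover have "{z. poly ?p z = 0} = UNIV" using assms(2) by (auto simp: poly_monom)
  ultimately show False using assms(1) by simp
qed

text \<open>
  The monomials are pairwise distinct characters of the multiplicative monoid \<open>'k\<^sup>v\<close>, as the field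
  is infinite, and distinct characters are linearly independent (Dedekind).
\<close>

lemma mpoly_eq_0_if_eval_0:
  fixes f :: "('v, 'k::field) mpoly"
  assumes inf: "infinite (UNIV :: 'k set)" and "\<And>a. eval_mpoly a f = 0"
  shows "f = 0"
proof -
  have indep: "\<forall>m\<in>S. c m = 0"
    if "finite S" "\<forall>a. (\<Sum>m\<in>S. c m * monomial_value a m) = 0"
    for S :: "('v \<Rightarrow>\<^sub>0 nat) set" and c :: "_ \<Rightarrow> 'k"
    using that
  proof (induction S arbitrary: c rule: finite_induct)
    case (insert n S)
    have *: "c n * monomial_value a n = - (\<Sum>m\<in>S. c m * monomial_value a m)" for a
      using insert.prems insert.hyps by (simp add: eq_neg_iff_add_eq_0)
    have "\<forall>m\<in>S. c m * (monomial_value b m - monomial_value b n) = 0" for b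
    proof (rule insert.IH, rule allI)
      fix a
      have "(\<Sum>m\<in>S. c m * (monomial_value b m - monomial_value b n) * monomial_value a m)
          = (\<Sum>m\<in>S. c m * monomial_value (\<lambda>v. a v * b v) m)
            - monomial_value b n * (\<Sum>m\<in>S. c m * monomial_value a m)"
        by (simp add: monomial_value_def power_mult_distrib prod.distrib algebra_simps
            sum_distrib_left sum_subtractf)
      also have "\<dots> = - (c n * monomial_value (\<lambda>v. a v * b v) n)
            + monomial_value b n * (c n * monomial_value a n)"
        unfolding * by simp
      also have "\<dots> = 0"
        by (simp add: monomial_value_def power_mult_distrib prod.distrib algebra_simps)
      finally show "(\<Sum>m\<in>S. c m * (monomial_value b m - monomial_value b n) * monomial_value a m) = 0" .
    qed
    moreover have "\<exists>b. monomial_value b m \<noteq> (monomial_value b n :: 'k)" if mn: "m \<noteq> n" for m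
    proof (rule ccontr)
      assume "\<not> ?thesis"
      then have eq: "monomial_value b m = (monomial_value b n :: 'k)" for b by blast
      obtain v where v: "Poly_Mapping.lookup m v \<noteq> Poly_Mapping.lookup n v"
        using mn poly_mapping_eqI[of m n] by blast
      have val: "monomial_value ((\<lambda>_. 1)(v := z)) l = z ^ Poly_Mapping.lookup l v"
        for z :: 'k and l
      proof -
        have "monomial_value ((\<lambda>_. 1)(v := z)) l =
            (\<Prod>w\<in>insert v (Poly_Mapping.keys l). ((\<lambda>_. 1)(v := z)) w ^ Poly_Mapping.lookup l w)"
          by (rule monomial_value_superset) auto
        also have "\<dots> = (\<Prod>w\<in>insert v (Poly_Mapping.keys l). if w = v then z ^ Poly_Mapping.lookup l v else 1)"
          by (rule prod.cong) auto
        also have "\<dots> = z ^ Poly_Mapping.lookup l v"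
          by (subst prod.delta) auto
        finally show ?thesis .
      qed
      have "z ^ Poly_Mapping.lookup m v = z ^ Poly_Mapping.lookup n v" for z :: 'k
        using eq[of "(\<lambda>_. 1)(v := z)"] unfolding val .
      then show False using infinite_power_eq_imp_eq[OF inf] v by blast
    qed
    ultimately have S0: "\<forall>m\<in>S. c m = 0"
      using insert.hyps by (metis eq_iff_diff_eq_0 mult_eq_0_iff)
    then have "c n * monomial_value (\<lambda>_. 1) n = 0" unfolding * by simp
    then have "c n = 0" by (simp add: monomial_value_def)
    then show ?case using S0 by simp
  qed simp
  have "\<forall>m\<in>Poly_Mapping.keys f. Poly_Mapping.lookup f m = 0"
    using assms(2) by (intro indep) (auto simp: eval_mpoly_superset[of "Poly_Mapping.keys f" f])
  then show ?thesis by (metis in_keys_iff poly_mapping_eqI lookup_zero)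
qed

section \<open>Homogeneous components\<close>

definition mdeg :: "('v \<Rightarrow>\<^sub>0 nat) \<Rightarrow> int" where
  "mdeg m = int (\<Sum>v\<in>Poly_Mapping.keys m. Poly_Mapping.lookup m v)"

lemma mdeg_add: "mdeg (m + n) = mdeg m + mdeg n"
proof -
  let ?S = "Poly_Mapping.keys m \<union> Poly_Mapping.keys n"
  have *: "mdeg l = int (\<Sum>v\<in>?S. Poly_Mapping.lookup l v)" if "Poly_Mapping.keys l \<subseteq> ?S" for l
    unfolding mdeg_def using that
    by (intro arg_cong[where f = int] sum.mono_neutral_left) (auto simp: in_keys_iff)
  show ?thesis
    using *[of m] *[of n] *[OF keys_add] by (simp add: lookup_add sum.distrib)
qed

lemma mdeg_0 [simp]: "mdeg 0 = 0"
  by (simp add: mdeg_def)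

lemma mdeg_nonneg: "0 \<le> mdeg m"
  unfolding mdeg_def by (rule of_nat_0_le_iff)

lemma mdeg_eq_0_iff: "mdeg m = 0 \<longleftrightarrow> m = 0"
proof
  assume "mdeg m = 0"
  then have "\<forall>v\<in>Poly_Mapping.keys m. Poly_Mapping.lookup m v = 0"
    by (simp add: mdeg_def del: of_nat_sum)
  then show "m = 0" by (metis in_keys_iff poly_mapping_eqI lookup_zero)
qed simp

lemma homog_iff: "(f :: ('v, 'k::zero) mpoly) \<in> homog d \<longleftrightarrow> (\<forall>m. Poly_Mapping.lookup f m \<noteq> 0 \<longrightarrow> mdeg m = d)"
  by (auto simp: homog_def mdeg_def in_keys_iff)

lemma finite_monomials_of_degree:
  "finite {m :: 'v::finite \<Rightarrow>\<^sub>0 nat. mdeg m = d}"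
proof -
  have "Poly_Mapping.lookup m v \<le> nat (mdeg m)" for m :: "'v \<Rightarrow>\<^sub>0 nat" and v
  proof (cases "v \<in> Poly_Mapping.keys m")
    case True
    then show ?thesis unfolding mdeg_def by (simp add: member_le_sum del: of_nat_sum)
  qed (simp add: in_keys_iff)
  then have "Poly_Mapping.lookup ` {m :: 'v \<Rightarrow>\<^sub>0 nat. mdeg m = d} \<subseteq> (UNIV \<rightarrow> {..nat d})"
    by auto
  moreover have "finite (UNIV \<rightarrow> {..nat d} :: ('v \<Rightarrow> nat) set)"
    using finite_PiE[of "UNIV :: 'v set" "\<lambda>_. {..nat d}"] by (simp add: PiE_UNIV_domain)
  ultimately have "finite (Poly_Mapping.lookup ` {m :: 'v \<Rightarrow>\<^sub>0 nat. mdeg m = d})"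
    by (rule finite_subset)
  then show ?thesis
    by (rule finite_imageD) (simp add: inj_on_def lookup_inject)
qed

definition hpart :: "int \<Rightarrow> ('v, 'k::comm_monoid_add) mpoly \<Rightarrow> ('v, 'k) mpoly" where
  "hpart d f = (\<Sum>m\<in>{m\<in>Poly_Mapping.keys f. mdeg m = d}.
     Poly_Mapping.single m (Poly_Mapping.lookup f m))"

lemma lookup_hpart:
  "Poly_Mapping.lookup (hpart d f) m = (if mdeg m = d then Poly_Mapping.lookup f m else 0)"
  by (auto simp: hpart_def lookup_sum lookup_single when_def in_keys_iff)

lemma hpart_homog: "hpart d f \<in> homog d"
  by (simp add: homog_iff lookup_hpart)

lemma hpart_of_homog: "f \<in> homog e \<Longrightarrow> hpart d f = (if d = e then f else 0)"
  by (rule poly_mapping_eqI) (auto simp: homog_iff lookup_hpart)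

lemma hpart_0 [simp]: "hpart d 0 = 0"
  by (simp add: hpart_def)

lemma hpart_add: "hpart d (f + g) = hpart d f + hpart d g"
  by (rule poly_mapping_eqI) (simp add: lookup_hpart lookup_add)

lemma hpart_sum: "hpart d (sum f S) = (\<Sum>i\<in>S. hpart d (f i))"
  by (induction S rule: infinite_finite_induct) (auto simp: hpart_add)

lemma hpart_neg: "d < 0 \<Longrightarrow> hpart d f = 0"
  by (rule poly_mapping_eqI) (metis lookup_hpart lookup_zero mdeg_nonneg not_le)

lemma homog_neg_eq_0: "f \<in> homog d \<Longrightarrow> d < 0 \<Longrightarrow> f = 0"
  by (rule poly_mapping_eqI) (metis homog_iff lookup_zero mdeg_nonneg not_le)

lemma homog_0_eq_0: "f \<in> homog 0 \<Longrightarrow> Poly_Mapping.lookup f 0 = 0 \<Longrightarrow> f = 0"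
  by (rule poly_mapping_eqI) (auto simp: homog_iff mdeg_eq_0_iff)

lemma homog_add: "(f :: ('v, 'k::comm_monoid_add) mpoly) \<in> homog d \<Longrightarrow> g \<in> homog d \<Longrightarrow> f + g \<in> homog d"
  by (simp add: homog_iff lookup_add) (metis add.left_neutral)

lemma homog_zero [simp]: "0 \<in> homog d"
  by (simp add: homog_iff)

lemma homog_sum: "(\<And>i. i \<in> S \<Longrightarrow> f i \<in> homog d) \<Longrightarrow> sum f S \<in> homog d"
  by (induction S rule: infinite_finite_induct) (auto simp: homog_add)

lemma homog_mult:
  assumes "f \<in> homog d" "g \<in> homog e"
  shows "f * g \<in> homog (d + e)"
  unfolding homog_def
proof safe
  fix m assume "m \<in> Poly_Mapping.keys (f * g)"
  then obtain a b where "m = a + b" "a \<in> Poly_Mapping.keys f" "b \<in> Poly_Mapping.keys g"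
    using keys_mult by blast
  then show "int (\<Sum>v\<in>Poly_Mapping.keys m. Poly_Mapping.lookup m v) = d + e"
    using assms mdeg_add[of a b] by (simp add: homog_iff in_keys_iff mdeg_def)
qed

lemma homog_single: "mdeg m = d \<Longrightarrow> Poly_Mapping.single m c \<in> homog d"
  by (auto simp: homog_iff lookup_single when_def)

lemma Const_homog: "Const c \<in> homog 0"
  by (auto simp: Const_def intro: homog_single)

lemma sum_hpart:
  assumes "finite D" "mdeg ` Poly_Mapping.keys f \<subseteq> D"
  shows "(\<Sum>d\<in>D. hpart d f) = f"
  using assms by (intro poly_mapping_eqI) (auto simp: lookup_sum lookup_hpart image_subset_iff in_keys_iff)

text \<open>
  Both sides are additive in \<open>g\<close>, and for homogeneous \<open>g\<close> the product is homogeneous.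
\<close>

lemma hpart_mult_homog:
  fixes h :: "('v, 'k::comm_ring_1) mpoly"
  assumes h: "h \<in> homog e"
  shows "hpart d (h * g) = h * hpart (d - e) g"
proof -
  define D where "D = insert (d - e) (mdeg ` Poly_Mapping.keys g)"
  have D: "finite D" by (simp add: D_def)
  have "(\<Sum>i\<in>D. hpart i g) = g" by (rule sum_hpart) (auto simp: D_def)
  then have "hpart d (h * g) = hpart d (\<Sum>i\<in>D. h * hpart i g)"
    by (simp flip: sum_distrib_left)
  also have "\<dots> = (\<Sum>i\<in>D. hpart d (h * hpart i g))" by (rule hpart_sum)
  also have "\<dots> = (\<Sum>i\<in>D. if i = d - e then h * hpart i g else 0)"
    by (rule sum.cong[OF refl], subst hpart_of_homog[OF homog_mult[OF h hpart_homog]]) auto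
  also have "\<dots> = h * hpart (d - e) g"
    using D by (simp add: D_def)
  finally show ?thesis .
qed

section \<open>Subalgebras generated by linear forms\<close>

lemma Const_0 [simp]: "Const 0 = 0" by (simp add: Const_def)
lemma Const_1 [simp]: "Const 1 = 1" by (simp add: Const_def)
lemma Const_add: "Const (a + b) = Const a + Const b" by (simp add: Const_def single_add)
lemma Const_sum: "Const (sum f S) = (\<Sum>m\<in>S. Const (f m))"
  by (induction S rule: infinite_finite_induct) (simp_all add: Const_add)
lemma Const_mult: "Const (a * b) = Const a * Const b" by (simp add: Const_def mult_single)
lemma Const_uminus: "Const (- a) = - Const a" by (simp add: Const_def single_uminus)

lemma adjoin_0 [simp]: "0 \<in> adjoin G" using adjoin.const[of 0 G] by simp
lemma adjoin_1 [simp]: "1 \<in> adjoin G" using adjoin.const[of 1 G] by simp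

lemma adjoin_sum: "(\<And>i. i \<in> S \<Longrightarrow> f i \<in> adjoin G) \<Longrightarrow> sum f S \<in> adjoin G"
  by (induction S rule: infinite_finite_induct) (auto intro: adjoin.add)

text \<open>
  A subalgebra generated by homogeneous elements is a graded subalgebra. For a product
  \<open>f * g\<close>, the factor \<open>f\<close> is first split into its components.
\<close>

lemma adjoin_hpart:
  assumes G: "G \<subseteq> homog 1" and f: "f \<in> adjoin G"
  shows "hpart d f \<in> adjoin G"
  using f
proof (induction f arbitrary: d)
  case (const c)
  then show ?case by (simp add: hpart_of_homog[OF Const_homog] adjoin.const)
next
  case (gen g)
  then have "g \<in> homog 1" using G by blast
  then show ?case using gen by (simp add: hpart_of_homog adjoin.gen)
next
  case (add f g)
  then show ?case by (simp add: hpart_add adjoin.add)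
next
  case (mult f g)
  let ?D = "mdeg ` Poly_Mapping.keys f"
  have "f = (\<Sum>e\<in>?D. hpart e f)" by (rule sum_hpart[symmetric]) auto
  then have "hpart d (f * g) = hpart d (\<Sum>e\<in>?D. hpart e f * g)"
    by (simp flip: sum_distrib_right)
  also have "\<dots> = (\<Sum>e\<in>?D. hpart d (hpart e f * g))" by (rule hpart_sum)
  also have "\<dots> = (\<Sum>e\<in>?D. hpart e f * hpart (d - e) g)"
    by (simp add: hpart_mult_homog[OF hpart_homog])
  finally show ?case using mult.IH by (auto intro!: adjoin_sum adjoin.mult)
qed

lemma adjoin_split_const:
  assumes "finite I" and f: "f \<in> adjoin (x ` I)"
  shows "\<exists>c g. f = Const c + (\<Sum>i\<in>I. x i * g i) \<and> (\<forall>i. g i \<in> adjoin (x ` I))"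
  using f
proof induction
  case (const c)
  then show ?case by (intro exI[of _ c] exI[of _ "\<lambda>_. 0"]) auto
next
  case (gen g)
  then obtain j where j: "j \<in> I" "g = x j" by auto
  have "(\<Sum>i\<in>I. x i * (if i = j then 1 else 0)) = (\<Sum>i\<in>I. if i = j then x i else 0)"
    by (rule sum.cong) auto
  then have "g = Const 0 + (\<Sum>i\<in>I. x i * (if i = j then 1 else 0))"
    using assms(1) j by simp
  moreover have "\<forall>i. (if i = j then 1 else 0) \<in> adjoin (x ` I)" by simp
  ultimately show ?case by (intro exI conjI)
next
  case (add f g)
  then obtain c d u v where "f = Const c + (\<Sum>i\<in>I. x i * u i)" "g = Const d + (\<Sum>i\<in>I. x i * v i)"
    and uv: "\<forall>i. u i \<in> adjoin (x ` I)" "\<forall>i. v i \<in> adjoin (x ` I)" by blast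
  then have "f + g = Const (c + d) + (\<Sum>i\<in>I. x i * (u i + v i))"
    by (simp add: Const_add distrib_left sum.distrib add_ac)
  moreover have "\<forall>i. u i + v i \<in> adjoin (x ` I)"
    using uv by (blast intro: adjoin.add)
  ultimately show ?case by (intro exI conjI)
next
  case (mult f g)
  then obtain c d u v where f: "f = Const c + (\<Sum>i\<in>I. x i * u i)" and g: "g = Const d + (\<Sum>i\<in>I. x i * v i)"
    and uv: "\<forall>i. u i \<in> adjoin (x ` I)" "\<forall>i. v i \<in> adjoin (x ` I)" by blast
  have "f * g = Const c * g + (\<Sum>i\<in>I. x i * u i) * g"
    unfolding f by (rule distrib_right)
  also have "(\<Sum>i\<in>I. x i * u i) * g = (\<Sum>i\<in>I. x i * (u i * g))"
    by (simp add: sum_distrib_right mult.assoc)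
  also have "Const c * g = Const (c * d) + (\<Sum>i\<in>I. x i * (Const c * v i))"
    unfolding g by (simp add: Const_mult distrib_left sum_distrib_left mult_ac)
  also have "\<dots> + (\<Sum>i\<in>I. x i * (u i * g)) = Const (c * d) + (\<Sum>i\<in>I. x i * (Const c * v i + u i * g))"
    by (simp add: distrib_left sum.distrib add.assoc)
  finally have "f * g = Const (c * d) + (\<Sum>i\<in>I. x i * (Const c * v i + u i * g))" .
  moreover have "\<forall>i. Const c * v i + u i * g \<in> adjoin (x ` I)"
    using uv mult.hyps(2) by (blast intro: adjoin.add adjoin.mult adjoin.const)
  ultimately show ?case by (intro exI conjI)
qed

text \<open>
  The constant term is the only obstruction to membership in the ideal of the linear forms, and the
  cofactors may be replaced by their components of the matching degree.
\<close>

lemma adjoin_homog_split: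
  fixes x :: "nat \<Rightarrow> ('v, 'k::comm_ring_1) mpoly"
  assumes I: "finite I" "x ` I \<subseteq> homog 1" and f: "f \<in> adjoin (x ` I)" "f \<in> homog d"
    and f0: "Poly_Mapping.lookup f 0 = 0"
  shows "\<exists>g. f = (\<Sum>i\<in>I. x i * g i) \<and> (\<forall>i. g i \<in> adjoin (x ` I) \<inter> homog (d - 1))"
proof -
  obtain c g where cg: "f = Const c + (\<Sum>i\<in>I. x i * g i)" "\<forall>i. g i \<in> adjoin (x ` I)"
    using adjoin_split_const[OF I(1) f(1)] by blast
  have hp: "hpart e f = hpart e (Const c) + (\<Sum>i\<in>I. x i * hpart (e - 1) (g i))" for e
  proof -
    have "hpart e (\<Sum>i\<in>I. x i * g i) = (\<Sum>i\<in>I. x i * hpart (e - 1) (g i))"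
      unfolding hpart_sum using I(2) by (intro sum.cong[OF refl] hpart_mult_homog) auto
    then show ?thesis unfolding cg(1) hpart_add by simp
  qed
  have "hpart 0 f = Const c"
    using hp[of 0] by (simp add: hpart_neg hpart_of_homog[OF Const_homog])
  then have "Poly_Mapping.lookup (Const c :: ('v, 'k) mpoly) 0 = Poly_Mapping.lookup f 0"
    using lookup_hpart[of 0 f 0] by simp
  then have "c = 0" using f0 by (simp add: Const_def)
  then have "f = (\<Sum>i\<in>I. x i * hpart (d - 1) (g i))"
    using hp[of d] unfolding hpart_of_homog[OF f(2), of d] by simp
  moreover have "\<forall>i. hpart (d - 1) (g i) \<in> adjoin (x ` I) \<inter> homog (d - 1)"
    using cg(2) by (simp add: hpart_homog adjoin_hpart[OF I(2)])
  ultimately show ?thesis by (intro exI conjI)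
qed

section \<open>Independent families and maps of maximal rank\<close>

lemma poly_det:
  fixes A :: "'k::comm_ring_1 poly mat"
  assumes "A \<in> carrier_mat n n"
  shows "poly (det A) z = det (mat n n (\<lambda>ij. poly (A $$ ij) z))"
proof -
  have sgn: "poly (signof p) z = (signof p :: 'k)" for p :: "nat \<Rightarrow> nat"
    by (cases "sign p = 1") (auto simp: sign_def)
  have p: "p i < n" if "p permutes {0..<n}" "i < n" for p and i :: nat
    using permutes_in_image[OF that(1), of i] that(2) by simp
  have "poly (det A) z = (\<Sum>p | p permutes {0..<n}. signof p * (\<Prod>i = 0..<n. poly (A $$ (i, p i)) z))"
    unfolding det_def'[OF assms] poly_sum poly_mult poly_prod sgn ..
  also have "\<dots> = (\<Sum>p | p permutes {0..<n}. signof p *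
      (\<Prod>i = 0..<n. mat n n (\<lambda>ij. poly (A $$ ij) z) $$ (i, p i)))"
    using p by (intro sum.cong arg_cong2[where f = "(*)"] prod.cong refl) auto
  also have "\<dots> = det (mat n n (\<lambda>ij. poly (A $$ ij) z))"
    by (rule det_def'[symmetric]) simp
  finally show ?thesis .
qed

lemma infinite_field_nonroot:
  assumes "infinite (UNIV :: 'k::field set)" "(p :: 'k poly) \<noteq> 0"
  shows "\<exists>z. poly p z \<noteq> 0"
proof (rule ccontr)
  assume "\<not> ?thesis"
  then have "{z. poly p z = 0} = UNIV" by auto
  then show False using poly_roots_finite[OF assms(2)] assms(1) by simp
qed

text \<open>
  A name of its own for vector spaces: what is added here is not inherited by the interpretation of
  \<open>vector_space\<close> for the real vector spaces.
\<close>

locale vspace = vector_space scale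
  for scale :: "'a::field \<Rightarrow> 'b::ab_group_add \<Rightarrow> 'b"
begin

definition indep_fam :: "nat \<Rightarrow> (nat \<Rightarrow> 'b) \<Rightarrow> bool" where
  "indep_fam n u \<longleftrightarrow> (\<forall>c. (\<Sum>j<n. scale (c j) (u j)) = 0 \<longrightarrow> (\<forall>j<n. c j = 0))"

lemma indep_famD: "indep_fam n u \<Longrightarrow> (\<Sum>j<n. scale (c j) (u j)) = 0 \<Longrightarrow> j < n \<Longrightarrow> c j = 0"
  by (auto simp: indep_fam_def)

lemma indep_fam_inj:
  assumes "indep_fam n u" shows "inj_on u {..<n}"
proof (rule inj_onI, rule ccontr)
  fix i j assume ij: "i \<in> {..<n}" "j \<in> {..<n}" "u i = u j" "i \<noteq> j"
  let ?c = "\<lambda>l. if l = i then 1 else if l = j then -1 else (0::'a)"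
  have "(\<Sum>l<n. scale (?c l) (u l)) = (\<Sum>l\<in>{i,j}. scale (?c l) (u l))"
    by (rule sum.mono_neutral_right) (use ij in auto)
  also have "\<dots> = 0" using ij by simp
  finally have "?c i = 0" using indep_famD[OF assms, of ?c i] ij(1) by simp
  then show False by simp
qed

lemma indep_fam_independent:
  assumes "indep_fam n u" shows "independent (u ` {..<n})"
proof
  assume "dependent (u ` {..<n})"
  then obtain c v where c: "v \<in> u ` {..<n}" "c v \<noteq> 0" "(\<Sum>v\<in>u ` {..<n}. scale (c v) v) = 0"
    unfolding dependent_finite[OF finite_imageI[OF finite_lessThan]] by blast
  then have "(\<Sum>j<n. scale (c (u j)) (u j)) = 0"
    by (simp add: sum.reindex[OF indep_fam_inj[OF assms]])
  then show False using indep_famD[OF assms, of "\<lambda>j. c (u j)"] c(1,2) by blast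
qed

lemma indep_fam_le_card:
  assumes "indep_fam n u" "finite T" "\<And>j. j < n \<Longrightarrow> u j \<in> span T"
  shows "n \<le> card T"
  using independent_span_bound[OF assms(2) indep_fam_independent[OF assms(1)]] assms(3)
    card_image[OF indep_fam_inj[OF assms(1)]]
  by (auto simp: image_subset_iff)

lemma indep_fam_extend:
  assumes u: "indep_fam n u" and a: "a \<notin> span (u ` {..<n})"
  shows "indep_fam (Suc n) (\<lambda>j. if j < n then u j else a)"
  unfolding indep_fam_def
proof (intro allI impI)
  fix c j assume c: "(\<Sum>j<Suc n. scale (c j) (if j < n then u j else a)) = 0" and j: "j < Suc n"
  have "(\<Sum>j<n. scale (c j) (u j)) + scale (c n) a = 0" using c by simp
  then have eq: "scale (c n) a = - (\<Sum>j<n. scale (c j) (u j))"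
    unfolding add_eq_0_iff .
  have cn: "c n = 0"
  proof (rule ccontr)
    assume "c n \<noteq> 0"
    then have "a = scale (inverse (c n)) (scale (c n) a)" by simp
    also have "\<dots> \<in> span (u ` {..<n})"
      unfolding eq by (intro span_scale span_neg span_sum span_base) auto
    finally show False using a by simp
  qed
  then have "(\<Sum>j<n. scale (c j) (u j)) = 0" using eq by simp
  then have "c j = 0" if "j < n" using indep_famD[OF u, of c j] that by simp
  then show "c j = 0" using cn j by (cases "j = n") auto
qed

text \<open>
  The coordinates with respect to a basis that extends the family.
\<close>

lemma indep_fam_dual:
  assumes "indep_fam n u"
  shows "\<exists>\<phi>. (\<forall>i. Vector_Spaces.linear scale (*) (\<phi> i)) \<and>
    (\<forall>i<n. \<forall>j<n. \<phi> i (u j) = (if i = j then 1 else 0))"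
proof -
  let ?B = "extend_basis (u ` {..<n})"
  note ind = indep_fam_independent[OF assms]
  have B: "independent ?B" "span ?B = UNIV" "u ` {..<n} \<subseteq> ?B"
    using independent_extend_basis[OF ind] span_extend_basis[OF ind] extend_basis_superset[OF ind]
    by auto
  have "representation ?B (u j) (u i) = (if i = j then 1 else 0)" if "i < n" "j < n" for i j
    using representation_basis[OF B(1), of "u j"] B(3) that indep_fam_inj[OF assms]
    by (auto simp: inj_on_def image_subset_iff)
  then show ?thesis
    using linear_representation[OF B(1,2)]
    by (intro exI[of _ "\<lambda>i v. representation ?B v (u i)"]) auto
qed

lemma linear_functional_sum:
  assumes "Vector_Spaces.linear scale (*) \<phi>"
  shows "\<phi> (\<Sum>j\<in>J. scale (c j) (u j)) = (\<Sum>j\<in>J. c j * \<phi> (u j))"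
proof -
  interpret Vector_Spaces.linear scale "(*)" \<phi> by fact
  show ?thesis by (simp add: sum scale)
qed

lemma indep_fam_if_det:
  assumes lin: "\<And>i. Vector_Spaces.linear scale (*) (\<phi> i)"
    and det: "det (mat n n (\<lambda>(i, j). \<phi> i (w j))) \<noteq> 0"
  shows "indep_fam n w"
  unfolding indep_fam_def
proof (intro allI impI)
  fix c j assume c: "(\<Sum>j<n. scale (c j) (w j)) = 0" and j: "j < n"
  let ?A = "mat n n (\<lambda>(i, j). \<phi> i (w j))"
  have "?A *\<^sub>v vec n c = 0\<^sub>v n"
  proof (rule eq_vecI)
    fix i assume "i < dim_vec (0\<^sub>v n :: 'a vec)"
    then have i: "i < n" by simp
    then have "(?A *\<^sub>v vec n c) $ i = (\<Sum>j<n. c j * \<phi> i (w j))"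
      by (simp add: scalar_prod_def atLeast0LessThan mult.commute)
    also have "\<dots> = \<phi> i 0"
      by (subst c[symmetric]) (simp add: linear_functional_sum[OF lin])
    also have "\<phi> i 0 = 0"
      using linear_functional_sum[OF lin, of i "\<lambda>_. 0" w "{}"] by simp
    finally show "(?A *\<^sub>v vec n c) $ i = 0\<^sub>v n $ i" using i by simp
  qed simp
  then have "vec n c = 0\<^sub>v n"
    using det det_0_iff_vec_prod_zero[of ?A n] by (meson mat_carrier vec_carrier)
  then show "c j = 0" using j by (metis index_vec index_zero_vec(1))
qed

text \<open>
  In terms of functionals dual to \<open>u\<close>, a Gram-type determinant of the perturbed family is a polynomial in
  \<open>z\<close> with value 1 at 0. It is multiplied by \<open>z\<close> below to obtain a point other than 0.
\<close>

lemma indep_fam_perturb: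
  assumes inf: "infinite (UNIV :: 'a set)" and u: "indep_fam n u"
  shows "\<exists>z. z \<noteq> 0 \<and> indep_fam n (\<lambda>j. u j + scale z (w j))"
proof -
  obtain \<phi> where lin: "\<And>i. Vector_Spaces.linear scale (*) (\<phi> i)"
    and dual: "\<And>i j. i < n \<Longrightarrow> j < n \<Longrightarrow> \<phi> i (u j) = (if i = j then 1 else 0)"
    using indep_fam_dual[OF u] by blast
  define P where "P = mat n n (\<lambda>(i, j). [:\<phi> i (u j), \<phi> i (w j):])"
  have \<phi>: "\<phi> i (u j + scale z (w j)) = \<phi> i (u j) + z * \<phi> i (w j)" for i j z
  proof -
    interpret Vector_Spaces.linear scale "(*)" "\<phi> i" by (rule lin)
    show ?thesis by (simp add: add scale)
  qed
  have val: "poly (det P) z = det (mat n n (\<lambda>(i, j). \<phi> i (u j + scale z (w j))))" for z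
  proof -
    have "mat n n (\<lambda>ij. poly (P $$ ij) z) = mat n n (\<lambda>(i, j). \<phi> i (u j + scale z (w j)))"
      by (rule eq_matI) (simp_all add: P_def \<phi>)
    then show ?thesis using poly_det[of P n z] by (simp add: P_def)
  qed
  have "mat n n (\<lambda>(i, j). \<phi> i (u j + scale 0 (w j))) = 1\<^sub>m n"
    by (rule eq_matI) (simp_all add: dual)
  then have "poly (det P) 0 = 1" unfolding val by simp
  then have "det P \<noteq> 0" by (metis poly_0 zero_neq_one)
  then have "[:0, 1:] * det P \<noteq> 0" by simp
  then obtain z where "poly ([:0, 1:] * det P) z \<noteq> 0"
    using infinite_field_nonroot[OF inf] by blast
  then have "z * det (mat n n (\<lambda>(i, j). \<phi> i (u j + scale z (w j)))) \<noteq> 0"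
    by (simp add: val)
  then have "z \<noteq> 0" "det (mat n n (\<lambda>(i, j). \<phi> i (u j + scale z (w j)))) \<noteq> 0"
    by simp_all
  moreover from this(2) have "indep_fam n (\<lambda>j. u j + scale z (w j))"
    by (rule indep_fam_if_det[OF lin])
  ultimately show ?thesis by (intro exI conjI)
qed

text \<open>
  Let \<open>a\<close> and \<open>b\<close> be the maps \<open>g \<mapsto> \<Sum>\<^sub>i A\<^sub>i g\<^sub>i\<close> and \<open>g \<mapsto> \<Sum>\<^sub>i B\<^sub>i g\<^sub>i\<close>. If no
  \<open>a - z b\<close> has a larger rank than \<open>a\<close>, then every \<open>f\<close> in the kernel of \<open>a\<close> is the constant term of a
  power series \<open>\<Sum>\<^sub>k z\<^sup>k F\<^sub>k\<close> killed by \<open>a - z b\<close>.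

  The \<open>F\<^sub>k\<close> are forced by a section of \<open>a\<close> built from functionals \<open>\<phi>\<^sub>j\<close> dual to
  \<open>a v\<^sub>0, \<dots>, a v\<^sub>n\<^sub>-\<^sub>1\<close>: the residual \<open>b F\<^sub>k - a F\<^sub>k\<^sub>+\<^sub>1\<close> is killed by all
  \<open>\<phi>\<^sub>j\<close>. Were \<open>m\<close> the first index with a nonzero residual, this residual would be independent of the
  \<open>a v\<^sub>j\<close>. Now the truncated series \<open>\<Sum>\<^sub>l\<^sub>\<le>\<^sub>m\<^sub>+\<^sub>1 z\<^sup>l F\<^sub>l\<close> is mapped by
  \<open>a - z b\<close> to \<open>- z\<^sup>m\<^sup>+\<^sup>1\<close> times a perturbation of that residual by a multiple of \<open>z\<close>, and the \<open>v\<^sub>j\<close> are mapped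
  to such perturbations of the \<open>a v\<^sub>j\<close>. For suitable \<open>z\<close> the image of \<open>a - z b\<close> would thus have dimension
  at least \<open>n + 1\<close>.
\<close>

lemma kernel_lifts_of_maximal_rank:
  fixes A B :: "nat \<Rightarrow> 'b \<Rightarrow> 'b"
  assumes inf: "infinite (UNIV :: 'a set)"
    and lin: "\<And>i. Vector_Spaces.linear scale scale (A i)" "\<And>i. Vector_Spaces.linear scale scale (B i)"
    and S: "subspace S"
    and v: "\<And>j i. v j i \<in> S" "indep_fam n (\<lambda>j. \<Sum>i\<in>I. A i (v j i))"
    and max: "\<And>z w. (\<And>j i. w j i \<in> S) \<Longrightarrow>
        \<not> indep_fam (Suc n) (\<lambda>j. \<Sum>i\<in>I. A i (w j i) - scale z (B i (w j i)))"
    and f: "\<And>i. f i \<in> S" "(\<Sum>i\<in>I. A i (f i)) = 0"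
  shows "\<exists>F. F 0 = f \<and> (\<forall>k i. F k i \<in> S) \<and>
    (\<forall>k. (\<Sum>i\<in>I. A i (F (Suc k) i)) = (\<Sum>i\<in>I. B i (F k i)))"
proof -
  define a where "a g = (\<Sum>i\<in>I. A i (g i))" for g
  define b where "b g = (\<Sum>i\<in>I. B i (g i))" for g
  have comb: "a (\<lambda>i. \<Sum>j\<in>J. scale (c j) (g j i)) = (\<Sum>j\<in>J. scale (c j) (a (g j)))"
       "b (\<lambda>i. \<Sum>j\<in>J. scale (c j) (g j i)) = (\<Sum>j\<in>J. scale (c j) (b (g j)))"
    for J :: "nat set" and c g
  proof -
    have lin_sum: "T (\<Sum>j\<in>J. scale (c j) (h j)) = (\<Sum>j\<in>J. scale (c j) (T (h j)))"
      if "Vector_Spaces.linear scale scale T" for T h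
    proof -
      interpret T: Vector_Spaces.linear scale scale T by (rule that)
      show ?thesis by (simp add: T.sum T.scale)
    qed
    show "a (\<lambda>i. \<Sum>j\<in>J. scale (c j) (g j i)) = (\<Sum>j\<in>J. scale (c j) (a (g j)))"
      by (simp add: a_def lin_sum[OF lin(1)] scale_sum_right sum.swap[of _ I])
    show "b (\<lambda>i. \<Sum>j\<in>J. scale (c j) (g j i)) = (\<Sum>j\<in>J. scale (c j) (b (g j)))"
      by (simp add: b_def lin_sum[OF lin(2)] scale_sum_right sum.swap[of _ I])
  qed
  obtain \<phi> where \<phi>: "\<And>i. Vector_Spaces.linear scale (*) (\<phi> i)"
    and dual: "\<And>i j. i < n \<Longrightarrow> j < n \<Longrightarrow> \<phi> i (a (v j)) = (if i = j then 1 else 0)"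
    using indep_fam_dual[OF v(2)] unfolding a_def by blast
  define F where "F = rec_nat f (\<lambda>_ g i. \<Sum>j<n. scale (\<phi> j (b g)) (v j i))"
  have F0: "F 0 = f" by (simp add: F_def)
  have FS: "F (Suc k) = (\<lambda>i. \<Sum>j<n. scale (\<phi> j (b (F k))) (v j i))" for k
    by (simp add: F_def)
  have FinS: "F k i \<in> S" for k i
    by (cases k) (auto simp: F0 f FS intro!: subspace_sum[OF S] subspace_scale[OF S] v)
  define res where "res k = b (F k) - a (F (Suc k))" for k
  have phi_res: "\<phi> i (res k) = 0" if "i < n" for i k
  proof -
    interpret \<phi>: Vector_Spaces.linear scale "(*)" "\<phi> i" by (rule \<phi>)
    have "\<phi> i (a (F (Suc k))) = (\<Sum>j<n. \<phi> j (b (F k)) * \<phi> i (a (v j)))"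
      by (simp add: FS comb linear_functional_sum[OF \<phi>])
    also have "\<dots> = (\<Sum>j<n. if j = i then \<phi> j (b (F k)) else 0)"
      using that by (intro sum.cong) (auto simp: dual)
    also have "\<dots> = \<phi> i (b (F k))" using that by simp
    finally show ?thesis by (simp add: res_def \<phi>.diff)
  qed
  have "res k = 0" for k
  proof (rule ccontr)
    assume "res k \<noteq> 0"
    define m where "m = (LEAST k. res k \<noteq> 0)"
    have m: "res m \<noteq> 0" and lt: "\<And>l. l < m \<Longrightarrow> res l = 0"
      unfolding m_def by (rule LeastI, fact) (blast dest: not_less_Least)
    define u where "u j = (if j < n then a (v j) else res m)" for j
    define w where "w j = (if j < n then - b (v j) else b (F (Suc m)))" for j
    have "indep_fam (Suc n) u"
      unfolding indep_fam_def
    proof (intro allI impI)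
      fix c j assume c: "(\<Sum>j<Suc n. scale (c j) (u j)) = 0" and j: "j < Suc n"
      have c': "(\<Sum>j<n. scale (c j) (a (v j))) + scale (c n) (res m) = 0"
        using c by (simp add: u_def)
      have ci: "c i = 0" if "i < n" for i
      proof -
        interpret \<phi>: Vector_Spaces.linear scale "(*)" "\<phi> i" by (rule \<phi>)
        have "\<phi> i ((\<Sum>j<n. scale (c j) (a (v j))) + scale (c n) (res m)) =
            (\<Sum>j<n. c j * \<phi> i (a (v j)))"
          by (simp add: \<phi>.add \<phi>.scale phi_res[OF that] linear_functional_sum[OF \<phi>])
        also have "\<dots> = (\<Sum>j<n. if j = i then c j else 0)"
          using that by (intro sum.cong) (auto simp: dual)
        also have "\<dots> = c i" using that by simp
        finally show ?thesis unfolding c' by (simp add: \<phi>.zero)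
      qed
      then have "c n = 0" using c' m by simp
      then show "c j = 0" using ci j by (cases "j = n") auto
    qed
    then obtain z where z: "z \<noteq> 0" and ind: "indep_fam (Suc n) (\<lambda>j. u j + scale z (w j))"
      using indep_fam_perturb[OF inf] by blast
    define g where "g i = (\<Sum>l<Suc (Suc m). scale (z ^ l) (F l i))" for i
    have ag: "a g - scale z (b g) = - scale (z ^ Suc m) (res m + scale z (b (F (Suc m))))"
    proof -
      have "a g = (\<Sum>l<Suc (Suc m). scale (z ^ l) (a (F l)))"
        "b g = (\<Sum>l<Suc (Suc m). scale (z ^ l) (b (F l)))"
        unfolding g_def[abs_def] by (simp_all only: comb)
      then have "a g - scale z (b g) = (\<Sum>l<Suc (Suc m). scale (z ^ l) (a (F l)))
           - (\<Sum>l<Suc (Suc m). scale (z ^ Suc l) (b (F l)))"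
        by (simp add: scale_sum_right algebra_simps)
      also have "(\<Sum>l<Suc (Suc m). scale (z ^ l) (a (F l))) =
          (\<Sum>l<Suc m. scale (z ^ Suc l) (a (F (Suc l))))"
        by (subst sum.lessThan_Suc_shift) (use f(2) in \<open>simp add: F0 a_def\<close>)
      also have "\<dots> - (\<Sum>l<Suc (Suc m). scale (z ^ Suc l) (b (F l))) =
          - (\<Sum>l<Suc m. scale (z ^ Suc l) (res l)) - scale (z ^ Suc (Suc m)) (b (F (Suc m)))"
        unfolding res_def by (simp add: sum_subtractf scale_right_diff_distrib del: power_Suc)
      \<comment> \<open>By minimality of \<open>m\<close> only the last residual survives.\<close>
      also have "(\<Sum>l<Suc m. scale (z ^ Suc l) (res l)) = scale (z ^ Suc m) (res m)"
        by (simp add: lt)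
      finally show ?thesis by (simp add: algebra_simps)
    qed
    \<comment> \<open>The arguments that \<open>a - z b\<close> maps to the perturbed independent family.\<close>
    define h where "h j i = (if j < n then v j i else scale (- inverse (z ^ Suc m)) (g i))" for j i
    have "g i \<in> S" for i
      unfolding g_def by (intro subspace_sum[OF S] subspace_scale[OF S] FinS)
    then have hS: "h j i \<in> S" for j i
      unfolding h_def using v(1) subspace_scale[OF S] by presburger
    have "a (h j) - scale z (b (h j)) = u j + scale z (w j)" for j
    proof (cases "j < n")
      case True
      then have "h j = v j" by (auto simp: h_def)
      then show ?thesis using True by (simp add: u_def w_def)
    next
      case False
      have "a (\<lambda>i. \<Sum>l\<in>{0::nat}. scale (- inverse (z ^ Suc m)) (g i)) =
          (\<Sum>l\<in>{0::nat}. scale (- inverse (z ^ Suc m)) (a g))" by (rule comb)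
      moreover have "b (\<lambda>i. \<Sum>l\<in>{0::nat}. scale (- inverse (z ^ Suc m)) (g i)) =
          (\<Sum>l\<in>{0::nat}. scale (- inverse (z ^ Suc m)) (b g))" by (rule comb)
      moreover have "h j = (\<lambda>i. scale (- inverse (z ^ Suc m)) (g i))"
        using False by (auto simp: h_def)
      ultimately have "a (h j) - scale z (b (h j)) =
          scale (- inverse (z ^ Suc m)) (a g - scale z (b g))"
        by (simp add: algebra_simps)
      also have "\<dots> = res m + scale z (b (F (Suc m)))"
        unfolding ag using z by (simp add: field_simps del: power_Suc)
      finally show ?thesis using False by (simp add: u_def w_def)
    qed
    then have "indep_fam (Suc n) (\<lambda>j. a (h j) - scale z (b (h j)))" using ind by simp
    moreover have "a (h j) - scale z (b (h j)) = (\<Sum>i\<in>I. A i (h j i) - scale z (B i (h j i)))" for j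
      by (simp add: a_def b_def scale_sum_right sum_subtractf)
    ultimately show False using max[OF hS] by simp
  qed
  then have "a (F (Suc k)) = b (F k)" for k by (simp add: res_def)
  then show ?thesis using F0 FinS unfolding a_def b_def by blast
qed

end

section \<open>Polynomial functions of the entries of a matrix\<close>

definition entry_poly :: "nat \<Rightarrow> (nat \<times> nat, 'k::zero) mpoly \<Rightarrow> bool" where
  "entry_poly r f \<longleftrightarrow> (\<forall>m\<in>Poly_Mapping.keys f. Poly_Mapping.keys m \<subseteq> {..<r} \<times> {..<r})"

text \<open>
  Regular functions on the space of matrices, in the form in which closed sets of the general linear
  group are described.
\<close>

definition polyfun :: "nat \<Rightarrow> ('k::comm_ring_1 mat \<Rightarrow> 'k) set" where
  "polyfun r = {F. \<exists>f. entry_poly r f \<and> F = (\<lambda>A. eval_mpoly (\<lambda>ij. A $$ ij) f)}"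

lemma polyfunI: "entry_poly r f \<Longrightarrow> (\<And>A. F A = eval_mpoly (\<lambda>ij. A $$ ij) f) \<Longrightarrow> F \<in> polyfun r"
  by (auto simp: polyfun_def)

lemma polyfunE:
  assumes "F \<in> polyfun r"
  obtains f where "entry_poly r f" "F = (\<lambda>A. eval_mpoly (\<lambda>ij. A $$ ij) f)"
  using assms unfolding polyfun_def by blast

lemma polyfun_const: "(\<lambda>_. c) \<in> polyfun r"
  by (rule polyfunI[of _ "Const c"]) (simp_all add: entry_poly_def Const_def)

lemma polyfun_coord:
  assumes "i < r" "j < r" shows "(\<lambda>A. A $$ (i, j)) \<in> polyfun r"
proof (rule polyfunI)
  show "entry_poly r (Var (i, j))" using assms by (simp add: entry_poly_def Var_def)
qed simp

lemma polyfun_add: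
  assumes "F \<in> polyfun r" "G \<in> polyfun r" shows "(\<lambda>A. F A + G A) \<in> polyfun r"
proof -
  obtain f where f: "entry_poly r f" "F = (\<lambda>A. eval_mpoly (\<lambda>ij. A $$ ij) f)"
    using polyfunE[OF assms(1)] .
  obtain g where g: "entry_poly r g" "G = (\<lambda>A. eval_mpoly (\<lambda>ij. A $$ ij) g)"
    using polyfunE[OF assms(2)] .
  show ?thesis
  proof (rule polyfunI)
    show "entry_poly r (f + g)"
      using f(1) g(1) keys_add[of f g] unfolding entry_poly_def by blast
  qed (simp add: f g)
qed

lemma polyfun_mult:
  assumes "F \<in> polyfun r" "G \<in> polyfun r" shows "(\<lambda>A. F A * G A) \<in> polyfun r"
proof -
  obtain f where f: "entry_poly r f" "F = (\<lambda>A. eval_mpoly (\<lambda>ij. A $$ ij) f)"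
    using polyfunE[OF assms(1)] .
  obtain g where g: "entry_poly r g" "G = (\<lambda>A. eval_mpoly (\<lambda>ij. A $$ ij) g)"
    using polyfunE[OF assms(2)] .
  show ?thesis
  proof (rule polyfunI)
    show "entry_poly r (f * g)"
      unfolding entry_poly_def
    proof
      fix m assume "m \<in> Poly_Mapping.keys (f * g)"
      then obtain a b where m: "m = a + b" "a \<in> Poly_Mapping.keys f" "b \<in> Poly_Mapping.keys g"
        using keys_mult by blast
      have "Poly_Mapping.keys m \<subseteq> Poly_Mapping.keys a \<union> Poly_Mapping.keys b"
        unfolding m by (rule keys_add)
      also have "\<dots> \<subseteq> {..<r} \<times> {..<r}" using m f(1) g(1) unfolding entry_poly_def by blast
      finally show "Poly_Mapping.keys m \<subseteq> {..<r} \<times> {..<r}" .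
    qed
  qed (simp add: f g)
qed

lemma polyfun_sum: "(\<And>i. i \<in> S \<Longrightarrow> F i \<in> polyfun r) \<Longrightarrow> (\<lambda>A. \<Sum>i\<in>S. F i A) \<in> polyfun r"
  by (induction S rule: infinite_finite_induct)
    (simp_all add: polyfun_const polyfun_add)

lemma polyfun_prod: "(\<And>i. i \<in> S \<Longrightarrow> F i \<in> polyfun r) \<Longrightarrow> (\<lambda>A. \<Prod>i\<in>S. F i A) \<in> polyfun r"
  by (induction S rule: infinite_finite_induct)
    (simp_all add: polyfun_const polyfun_mult)

lemma polyfun_det:
  assumes "\<And>i j. i < n \<Longrightarrow> j < n \<Longrightarrow> (\<lambda>A. F A i j) \<in> polyfun r"
  shows "(\<lambda>A. det (mat n n (\<lambda>(i, j). F A i j))) \<in> polyfun r"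
proof -
  have p: "p i < n" if "p permutes {0..<n}" "i < n" for p and i :: nat
    using permutes_in_image[OF that(1), of i] that(2) by simp
  have "det (mat n n (\<lambda>(i, j). F A i j)) =
      (\<Sum>p | p permutes {0..<n}. signof p * (\<Prod>i = 0..<n. F A i (p i)))" for A
  proof -
    have "det (mat n n (\<lambda>(i, j). F A i j)) = (\<Sum>p | p permutes {0..<n}. signof p *
        (\<Prod>i = 0..<n. mat n n (\<lambda>(i, j). F A i j) $$ (i, p i)))"
      by (rule det_def') simp
    also have "\<dots> = (\<Sum>p | p permutes {0..<n}. signof p * (\<Prod>i = 0..<n. F A i (p i)))"
      using p by (intro sum.cong arg_cong2[where f = "(*)"] prod.cong refl) auto
    finally show ?thesis .
  qed
  then show ?thesis
    by (simp only:) (rule polyfun_sum, rule polyfun_mult[OF polyfun_const], rule polyfun_prod,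
        rule assms, auto intro: p)
qed

lemma polyfun_det_matrix: "\<exists>F\<in>polyfun r. \<forall>A\<in>carrier_mat r r. F A = det A"
proof (intro bexI ballI)
  show "(\<lambda>A. det (mat r r (\<lambda>(i, j). A $$ (i, j)))) \<in> polyfun r"
    by (intro polyfun_det polyfun_coord)
  fix A :: "'a mat" assume "A \<in> carrier_mat r r"
  then have "mat r r (\<lambda>(i, j). A $$ (i, j)) = A" by (intro eq_matI) auto
  then show "det (mat r r (\<lambda>(i, j). A $$ (i, j))) = det A" by simp
qed

lemma polyfun_adj_mat:
  assumes "i < r" "j < r"
  shows "\<exists>F\<in>polyfun r. \<forall>A\<in>carrier_mat r r. F A = adj_mat A $$ (i, j)"
proof (intro bexI ballI)
  let ?F = "\<lambda>A. (-1) ^ (j + i) * det (mat (r - 1) (r - 1)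
    (\<lambda>(a, b). A $$ (if a < j then a else Suc a, if b < i then b else Suc b)))"
  show "?F \<in> polyfun r"
    by (intro polyfun_mult polyfun_const polyfun_det polyfun_coord) auto
  fix A :: "'a mat" assume "A \<in> carrier_mat r r"
  then show "?F A = adj_mat A $$ (i, j)"
    using assms by (auto simp: adj_mat_def cofactor_def mat_delete_def)
qed

lemma polyfun_line:
  assumes "F \<in> polyfun r"
  shows "\<exists>p. \<forall>z. F (mat r r (\<lambda>ij. A $$ ij + z * D $$ ij)) = poly p z"
proof -
  obtain f where f: "entry_poly r f" and F: "F = (\<lambda>A. eval_mpoly (\<lambda>ij. A $$ ij) f)"
    using polyfunE[OF assms] .
  let ?p = "\<Sum>m\<in>Poly_Mapping.keys f. [:Poly_Mapping.lookup f m:] *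
    (\<Prod>ij\<in>Poly_Mapping.keys m. [:A $$ ij, D $$ ij:] ^ Poly_Mapping.lookup m ij)"
  have "F (mat r r (\<lambda>ij. A $$ ij + z * D $$ ij)) = poly ?p z" for z
  proof -
    have "(mat r r (\<lambda>ij. A $$ ij + z * D $$ ij)) $$ ij = poly [:A $$ ij, D $$ ij:] z"
      if "m \<in> Poly_Mapping.keys f" "ij \<in> Poly_Mapping.keys m" for m ij
      using f that unfolding entry_poly_def by (cases ij) force
    then show ?thesis
      unfolding F eval_mpoly_def poly_sum poly_mult poly_prod poly_power
      by (intro sum.cong arg_cong2[where f = "(*)"] prod.cong refl) simp_all
  qed
  then show ?thesis by (intro exI allI)
qed

text \<open>
  Affine space over an infinite field is irreducible: join a nonzero of the product found so far to a nonzero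
  of the next function by a line. On this line both functions are nonzero univariate polynomials.
\<close>

lemma polyfun_common_nonzero:
  fixes S :: "('k::field mat \<Rightarrow> 'k) set"
  assumes inf: "infinite (UNIV :: 'k set)" and "finite S"
    and "\<And>F. F \<in> S \<Longrightarrow> F \<in> polyfun r \<and> (\<exists>A\<in>carrier_mat r r. F A \<noteq> 0)"
  shows "\<exists>A\<in>carrier_mat r r. \<forall>F\<in>S. F A \<noteq> 0"
  using assms(2,3)
proof (induction S)
  case empty
  then show ?case by (intro bexI[of _ "0\<^sub>m r r"]) auto
next
  case (insert F S)
  then obtain A where A: "A \<in> carrier_mat r r" "\<forall>F\<in>S. F A \<noteq> 0" by auto
  obtain B where B: "B \<in> carrier_mat r r" "F B \<noteq> 0" using insert.prems by blast
  define L where "L z = mat r r (\<lambda>ij. A $$ ij + z * (B - A) $$ ij)" for z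
  define G where "G = (\<lambda>A. \<Prod>F\<in>S. F A)"
  have G: "G \<in> polyfun r" unfolding G_def using insert.prems by (intro polyfun_prod) simp
  obtain p where p: "\<forall>z. G (L z) = poly p z"
    using polyfun_line[OF G, of A "B - A"] unfolding L_def by (elim exE)
  have F: "F \<in> polyfun r" using insert.prems by simp
  obtain q where q: "\<forall>z. F (L z) = poly q z"
    using polyfun_line[OF F, of A "B - A"] unfolding L_def by (elim exE)
  have L: "L 0 = A" "L 1 = B"
    unfolding L_def using A(1) B(1) by (auto intro!: eq_matI)
  have "G A \<noteq> 0" unfolding G_def using A insert.hyps by simp
  then have "poly p 0 \<noteq> 0" using p L by metis
  moreover have "poly q 1 \<noteq> 0" using q L B by metis
  ultimately have "p \<noteq> 0" "q \<noteq> 0" by auto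
  then have "p * q \<noteq> 0" by simp
  then obtain z where "poly (p * q) z \<noteq> 0" using infinite_field_nonroot[OF inf] by blast
  then have "G (L z) \<noteq> 0" "F (L z) \<noteq> 0" using p q by simp_all
  then have "\<forall>F\<in>insert F S. F (L z) \<noteq> 0"
    using insert.hyps(1) by (auto simp: G_def)
  moreover have "L z \<in> carrier_mat r r" by (simp add: L_def)
  ultimately show ?case by (intro bexI)
qed

section \<open>Graded modules over the polynomial ring\<close>

locale graded_mpoly_module =
  fixes scale :: "('v::finite, 'k::field) mpoly \<Rightarrow> 'e::ab_group_add \<Rightarrow> 'e" and gr :: "int \<Rightarrow> 'e set"
  assumes graded: "graded_module scale gr"
begin

abbreviation kscale :: "'k \<Rightarrow> 'e \<Rightarrow> 'e" where
  "kscale c \<equiv> scale (Const c)"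

sublocale M: Modules.module scale
  using graded by (simp add: graded_module_def)

sublocale K: vspace kscale
  by unfold_locales (simp_all add: M.scale_right_distrib M.scale_left_distrib Const_add Const_mult)

lemma gr_zero [simp]: "0 \<in> gr d"
  and gr_diff: "u \<in> gr d \<Longrightarrow> v \<in> gr d \<Longrightarrow> u - v \<in> gr d"
  and gr_scale': "f \<in> homog a \<Longrightarrow> u \<in> gr d \<Longrightarrow> scale f u \<in> gr (a + d)"
  and gr_decomposition:
    "\<exists>!c. finite {d. c d \<noteq> 0} \<and> (\<forall>d. c d \<in> gr d) \<and> u = (\<Sum>d | c d \<noteq> 0. c d)"
  using graded by (simp_all add: graded_module_def)

lemma gr_scale: "f \<in> homog a \<Longrightarrow> u \<in> gr d \<Longrightarrow> a + d = e \<Longrightarrow> scale f u \<in> gr e"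
  using gr_scale' by blast

lemma gr_add: "u \<in> gr d \<Longrightarrow> v \<in> gr d \<Longrightarrow> u + v \<in> gr d"
  using gr_diff[of u d "0 - v"] gr_diff[of 0 d v] by simp

lemma gr_sum: "(\<And>i. i \<in> S \<Longrightarrow> f i \<in> gr d) \<Longrightarrow> sum f S \<in> gr d"
  by (induction S rule: infinite_finite_induct) (simp_all add: gr_add)

lemma gr_kscale: "u \<in> gr d \<Longrightarrow> kscale c u \<in> gr d"
  using gr_scale[OF Const_homog] by simp

lemma subspace_gr: "K.subspace (gr d)"
  by (rule K.subspaceI) (simp_all add: gr_add gr_kscale)

lemma linear_scale: "Vector_Spaces.linear kscale kscale (scale f)"
  by unfold_locales (simp_all add: M.scale_right_distrib mult.commute)

text \<open>
  The one place where the uniqueness of the decomposition into homogeneous components enters.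
\<close>

lemma homogeneous_component:
  assumes "finite D" "\<And>d. w d \<in> gr d" "(\<Sum>d\<in>D. w d) \<in> gr e" "e \<in> D"
  shows "(\<Sum>d\<in>D. w d) = w e"
proof -
  let ?u = "\<Sum>d\<in>D. w d"
  define c1 where "c1 = (\<lambda>d. if d = e then ?u else 0)"
  define c2 where "c2 = (\<lambda>d. if d \<in> D then w d else 0)"
  have sub1: "{d. c1 d \<noteq> 0} \<subseteq> {e}" and sub2: "{d. c2 d \<noteq> 0} \<subseteq> D"
    by (auto simp: c1_def c2_def)
  have "(\<Sum>d | c1 d \<noteq> 0. c1 d) = (\<Sum>d\<in>{e}. c1 d)"
    using sub1 by (intro sum.mono_neutral_left) auto
  then have 1: "?u = (\<Sum>d | c1 d \<noteq> 0. c1 d)" by (simp add: c1_def)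
  have "(\<Sum>d | c2 d \<noteq> 0. c2 d) = (\<Sum>d\<in>D. c2 d)"
    using sub2 assms(1) by (intro sum.mono_neutral_left) auto
  then have 2: "?u = (\<Sum>d | c2 d \<noteq> 0. c2 d)" by (simp add: c2_def)
  have "finite {d. c1 d \<noteq> 0}" "finite {d. c2 d \<noteq> 0}"
    using sub1 sub2 assms(1) by (auto intro: finite_subset)
  moreover have "\<forall>d. c1 d \<in> gr d" "\<forall>d. c2 d \<in> gr d"
    using assms by (auto simp: c1_def c2_def)
  ultimately have "c1 = c2"
    using gr_decomposition[of ?u] 1 2 by blast
  then have "c1 e = c2 e" by simp
  then show ?thesis using assms(4) by (simp add: c1_def c2_def)
qed

definition generated_by :: "('v, 'k) mpoly set \<Rightarrow> nat \<Rightarrow> (nat \<Rightarrow> int) \<Rightarrow> (nat \<Rightarrow> 'e) \<Rightarrow> bool" where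
  "generated_by A Q \<kappa> e \<longleftrightarrow> (\<forall>i<Q. e i \<in> gr (- \<kappa> i)) \<and>
     (\<forall>u. \<exists>v. (\<forall>i<Q. v i \<in> A) \<and> u = (\<Sum>i<Q. scale (v i) (e i)))"

text \<open>
  The coefficients of a homogeneous element with respect to homogeneous generators can be chosen
  homogeneous: sort the combination by degrees and compare the components of degree \<open>d\<close>.
\<close>

lemma homogeneous_combination:
  fixes Q :: nat
  assumes e: "\<And>i. i < Q \<Longrightarrow> e i \<in> gr (- \<kappa> i)" and u: "u \<in> gr d"
    and uv: "u = (\<Sum>i<Q. scale (v i) (e i))"
  shows "u = (\<Sum>i<Q. scale (hpart (d + \<kappa> i) (v i)) (e i))"
proof -
  define D where "D = insert d (\<Union>i<Q. (\<lambda>m. mdeg m - \<kappa> i) ` Poly_Mapping.keys (v i))"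
  have D: "finite D" "d \<in> D"
    unfolding D_def by (intro finite.insertI finite_UN_I finite_imageI finite_keys finite_lessThan) simp_all
  define w where "w d = (\<Sum>i<Q. scale (hpart (d + \<kappa> i) (v i)) (e i))" for d
  have w: "w d \<in> gr d" for d
    unfolding w_def by (intro gr_sum gr_scale[OF hpart_homog]) (auto intro: e)
  have "(\<Sum>d\<in>D. hpart (d + \<kappa> i) (v i)) = v i" if "i < Q" for i
  proof -
    have "(\<Sum>d\<in>D. hpart (d + \<kappa> i) (v i)) = (\<Sum>d\<in>(\<lambda>d. d + \<kappa> i) ` D. hpart d (v i))"
      by (subst sum.reindex) (auto simp: inj_on_def)
    also have "\<dots> = v i"
    proof (rule sum_hpart)
      show "mdeg ` Poly_Mapping.keys (v i) \<subseteq> (\<lambda>d. d + \<kappa> i) ` D"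
      proof safe
        fix m assume "m \<in> Poly_Mapping.keys (v i)"
        then have "mdeg m - \<kappa> i \<in> D" using that by (auto simp: D_def)
        then show "mdeg m \<in> (\<lambda>d. d + \<kappa> i) ` D" by (metis diff_add_cancel image_eqI)
      qed
    qed (use D in simp)
    finally show ?thesis .
  qed
  then have "u = (\<Sum>i<Q. scale (\<Sum>d\<in>D. hpart (d + \<kappa> i) (v i)) (e i))"
    unfolding uv by simp
  also have "\<dots> = (\<Sum>d\<in>D. w d)"
    unfolding w_def by (subst sum.swap) (simp add: M.scale_sum_left)
  finally have "u = (\<Sum>d\<in>D. w d)" .
  then have "u = w d"
    using homogeneous_component[of D w d] w D u by simp
  then show ?thesis by (simp add: w_def)
qed

lemma generated_by_homogeneous:
  assumes gen: "generated_by (adjoin X) Q \<kappa> e" and X: "X \<subseteq> homog 1" and u: "u \<in> gr d"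
  shows "\<exists>v. (\<forall>i<Q. v i \<in> adjoin X \<inter> homog (d + \<kappa> i)) \<and> u = (\<Sum>i<Q. scale (v i) (e i))"
proof -
  obtain v where v: "\<forall>i<Q. v i \<in> adjoin X" "u = (\<Sum>i<Q. scale (v i) (e i))"
    using gen unfolding generated_by_def by blast
  have "u = (\<Sum>i<Q. scale (hpart (d + \<kappa> i) (v i)) (e i))"
    using gen v(2) u by (intro homogeneous_combination) (auto simp: generated_by_def)
  moreover have "\<forall>i<Q. hpart (d + \<kappa> i) (v i) \<in> adjoin X \<inter> homog (d + \<kappa> i)"
    using v(1) adjoin_hpart[OF X] by (simp add: hpart_homog)
  ultimately show ?thesis by (intro exI[of _ "\<lambda>i. hpart (d + \<kappa> i) (v i)"] conjI)
qed

lemma gr_eq_0_below_generators: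
  assumes gen: "generated_by (adjoin X) Q \<kappa> e" and X: "X \<subseteq> homog 1"
    and low: "\<And>i. i < Q \<Longrightarrow> d < - \<kappa> i" and u: "u \<in> gr d"
  shows "u = 0"
proof -
  obtain v where v: "\<forall>i<Q. v i \<in> adjoin X \<inter> homog (d + \<kappa> i)" "u = (\<Sum>i<Q. scale (v i) (e i))"
    using generated_by_homogeneous[OF gen X u] by blast
  have "v i = 0" if "i < Q" for i
    using v(1) low[OF that] that homog_neg_eq_0[of "v i" "d + \<kappa> i"] by auto
  then show ?thesis using v(2) by simp
qed

text \<open>
  In degrees above those of the generators all coefficients are of positive degree, so a linear form can
  be split off from each of them.
\<close>

lemma gr_Suc_above_generators:
  assumes gen: "generated_by (adjoin (x ` I)) Q \<kappa> e" and X: "x ` I \<subseteq> homog 1" and I: "finite I"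
    and high: "\<And>i. i < Q \<Longrightarrow> - \<kappa> i \<le> d" and u: "u \<in> gr (d + 1)"
  shows "\<exists>g. (\<forall>l. g l \<in> gr d) \<and> u = (\<Sum>l\<in>I. scale (x (l::nat)) (g l))"
proof -
  obtain v where v: "\<forall>i<Q. v i \<in> adjoin (x ` I) \<inter> homog (d + 1 + \<kappa> i)"
    "u = (\<Sum>i<Q. scale (v i) (e i))"
    using generated_by_homogeneous[OF gen X u] by blast
  have "\<exists>g. v i = (\<Sum>l\<in>I. x l * g l) \<and> (\<forall>l. g l \<in> homog (d + \<kappa> i))" if i: "i < Q" for i
  proof -
    have vi: "v i \<in> adjoin (x ` I)" "v i \<in> homog (d + 1 + \<kappa> i)" using v(1) i by auto
    have "Poly_Mapping.lookup (v i) 0 = 0"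
      using vi(2) high[OF i] mdeg_0 unfolding homog_iff by force
    then show ?thesis
      using adjoin_homog_split[OF I X vi] by (auto simp: add_ac)
  qed
  then obtain g where g: "\<And>i. i < Q \<Longrightarrow> v i = (\<Sum>l\<in>I. x l * g i l)"
    "\<And>i l. i < Q \<Longrightarrow> g i l \<in> homog (d + \<kappa> i)"
    by metis
  have "u = (\<Sum>i<Q. \<Sum>l\<in>I. scale (x l) (scale (g i l) (e i)))"
    unfolding v(2) using g(1) by (simp add: M.scale_sum_left)
  also have "\<dots> = (\<Sum>l\<in>I. scale (x l) (\<Sum>i<Q. scale (g i l) (e i)))"
    by (subst sum.swap) (simp add: M.scale_sum_right)
  finally have "u = (\<Sum>l\<in>I. scale (x l) (\<Sum>i<Q. scale (g i l) (e i)))" .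
  moreover have "(\<Sum>i<Q. scale (g i l) (e i)) \<in> gr d" for l
    using gen by (intro gr_sum gr_scale[OF g(2)]) (auto simp: generated_by_def)
  ultimately show ?thesis by (intro exI[of _ "\<lambda>l. \<Sum>i<Q. scale (g i l) (e i)"]) simp
qed

text \<open>
  The products of generators and monomials of the matching degrees span.
\<close>

lemma gr_finite_dimensional:
  assumes gen: "generated_by (adjoin X) Q \<kappa> e" and X: "X \<subseteq> homog 1"
  shows "\<exists>T. finite T \<and> gr d \<subseteq> K.span T"
proof -
  let ?T = "\<Union>i<Q. (\<lambda>m. scale (Poly_Mapping.single m 1) (e i)) ` {m. mdeg m = d + \<kappa> i}"
  have "u \<in> K.span ?T" if u: "u \<in> gr d" for u
  proof -
    obtain v where v: "\<forall>i<Q. v i \<in> adjoin X \<inter> homog (d + \<kappa> i)" "u = (\<Sum>i<Q. scale (v i) (e i))"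
      using generated_by_homogeneous[OF gen X u] by blast
    have "scale (v i) (e i) \<in> K.span ?T" if i: "i < Q" for i
    proof -
      have single: "Poly_Mapping.single m c = Const c * Poly_Mapping.single m 1" for m :: "'v \<Rightarrow>\<^sub>0 nat" and c :: 'k
        by (simp add: Const_def mult_single)
      have "v i = (\<Sum>m\<in>Poly_Mapping.keys (v i).
          Const (Poly_Mapping.lookup (v i) m) * Poly_Mapping.single m 1)"
        using mpoly_sum_singles[of "v i"] unfolding single[symmetric] .
      then have "scale (v i) (e i) = scale (\<Sum>m\<in>Poly_Mapping.keys (v i).
          Const (Poly_Mapping.lookup (v i) m) * Poly_Mapping.single m 1) (e i)"
        by simp
      also have "\<dots> = (\<Sum>m\<in>Poly_Mapping.keys (v i).
          kscale (Poly_Mapping.lookup (v i) m) (scale (Poly_Mapping.single m 1) (e i)))"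
        by (simp add: M.scale_sum_left)
      also have "\<dots> \<in> K.span ?T"
      proof (intro K.span_sum K.span_scale K.span_base)
        fix m assume "m \<in> Poly_Mapping.keys (v i)"
        then have "mdeg m = d + \<kappa> i" using v(1) i by (auto simp: homog_iff in_keys_iff)
        then show "scale (Poly_Mapping.single m 1) (e i) \<in> ?T" using i by blast
      qed
      finally show ?thesis .
    qed
    then show ?thesis unfolding v(2) by (intro K.span_sum) auto
  qed
  moreover have "finite ?T" using finite_monomials_of_degree by blast
  ultimately show ?thesis by blast
qed

end

section \<open>Changing coordinates\<close>

lemma GL_iff_det: "A \<in> GL r \<longleftrightarrow> A \<in> carrier_mat r r \<and> det A \<noteq> 0"
proof safe
  assume A: "A \<in> GL r"
  then show Ac: "A \<in> carrier_mat r r" by (simp add: GL_def)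
  assume det0: "det A = 0"
  obtain B where B: "A * B = 1\<^sub>m r" "B * A = 1\<^sub>m (dim_row B)"
    using A Ac unfolding GL_def invertible_mat_def inverts_mat_def by auto
  then have "dim_col B = r" "dim_row B = r"
    using Ac by (metis carrier_matD(2) index_mult_mat(3) index_one_mat(3))+
  then have "det (A * B) = det A * det B" using Ac by (intro det_mult) auto
  then show False using B(1) det0 by simp
next
  assume A: "A \<in> carrier_mat r r" and det: "det A \<noteq> 0"
  let ?B = "inverse (det A) \<cdot>\<^sub>m adj_mat A"
  have "A * ?B = 1\<^sub>m r" "?B * A = 1\<^sub>m r"
    using adj_mat[OF A] det mult_smult_distrib[OF A adj_mat(1)[OF A]]
      mult_smult_assoc_mat[OF adj_mat(1)[OF A] A]
    by (auto intro!: eq_matI)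
  then show "A \<in> GL r"
    using A adj_mat(1)[OF A] unfolding GL_def invertible_mat_def inverts_mat_def
    by (auto intro!: exI[of _ ?B])
qed

text \<open>
  Cramer's rule: up to the unit \<open>det \<Gamma>\<close>, the coordinates depend polynomially on \<open>\<Gamma>\<close>.
\<close>

lemma new_coordinates_adj:
  assumes \<Gamma>: "\<Gamma> \<in> carrier_mat r r" and x: "new_coordinates r y \<Gamma> x" and j: "j < r"
  shows "Const (det \<Gamma>) * x j = (\<Sum>m<r. Const (adj_mat \<Gamma> $$ (m, j)) * Var (y m))"
proof -
  have prod: "(\<Sum>m<r. \<Gamma> $$ (l, m) * adj_mat \<Gamma> $$ (m, j)) = (if l = j then det \<Gamma> else 0)" if "l < r" for l
  proof -
    have "(\<Sum>m<r. \<Gamma> $$ (l, m) * adj_mat \<Gamma> $$ (m, j)) = (\<Gamma> * adj_mat \<Gamma>) $$ (l, j)"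
      using \<Gamma> adj_mat(1)[OF \<Gamma>] that j by (simp add: scalar_prod_def atLeast0LessThan)
    then show ?thesis using adj_mat(2)[OF \<Gamma>] that j by simp
  qed
  have "(\<Sum>m<r. Const (adj_mat \<Gamma> $$ (m, j)) * Var (y m)) =
      (\<Sum>m<r. \<Sum>l<r. Const (\<Gamma> $$ (l, m) * adj_mat \<Gamma> $$ (m, j)) * x l)"
    using x unfolding new_coordinates_def
    by (intro sum.cong) (simp_all add: sum_distrib_left Const_mult mult_ac)
  also have "\<dots> = (\<Sum>l<r. Const (\<Sum>m<r. \<Gamma> $$ (l, m) * adj_mat \<Gamma> $$ (m, j)) * x l)"
    by (subst sum.swap) (simp add: Const_sum sum_distrib_right)
  also have "\<dots> = (\<Sum>l<r. if l = j then Const (det \<Gamma>) * x l else 0)"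
    by (rule sum.cong) (auto simp: prod)
  finally show ?thesis using j by simp
qed

text \<open>
  The linear form by which W acts on the module.
\<close>

definition base_form :: "nat \<Rightarrow> (nat \<Rightarrow> ('v, 'k::comm_ring_1) mpoly) \<Rightarrow> (nat \<Rightarrow> 'k) \<Rightarrow> ('v, 'k) mpoly" where
  "base_form \<rho> x s = x 0 + (\<Sum>j\<in>{1..<\<rho>}. Const (s j) * x j)"

lemma base_form_sum:
  assumes "1 \<le> \<rho>"
  shows "base_form \<rho> x s = (\<Sum>j<\<rho>. Const ((s(0 := 1)) j) * x j)"
proof -
  have "{..<\<rho>} = insert 0 {1..<\<rho>}" using assms by auto
  then show ?thesis by (simp add: base_form_def)
qed

lemma base_form_homog:
  assumes "new_coordinates r y \<Gamma> x" "1 \<le> \<rho>" "\<rho> \<le> r"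
  shows "base_form \<rho> x s \<in> homog 1"
  unfolding base_form_sum[OF assms(2)]
proof (rule homog_sum)
  fix j assume "j \<in> {..<\<rho>}"
  then have "x j \<in> homog 1" using assms by (auto simp: new_coordinates_def)
  then show "Const ((s(0 := 1)) j) * x j \<in> homog 1"
    using homog_mult[OF Const_homog] by fastforce
qed

text \<open>
  The perturbations of the forms \<open>x\<^sub>l\<close>, \<open>\<rho> \<le> l\<close>, by multiples of \<open>base_form\<close> arise from a
  change of coordinates, since \<open>base_form\<close> only involves the remaining forms: the transformation N is
  unitriangular.
\<close>

lemma new_coordinates_shear:
  assumes \<Gamma>: "\<Gamma> \<in> GL r" and x: "new_coordinates r y \<Gamma> x" and \<rho>: "1 \<le> \<rho>" "\<rho> \<le> r"
    and x': "x' = (\<lambda>i. if \<rho> \<le> i then x i - Const (t i) * base_form \<rho> x s else x i)"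
  shows "\<exists>\<Gamma>'\<in>GL r. new_coordinates r y \<Gamma>' x'"
proof
  define \<sigma> where "\<sigma> = s(0 := 1)"
  define N where "N = mat r r (\<lambda>(j, l). if j = l then 1 else if j < \<rho> \<and> \<rho> \<le> l then \<sigma> j * t l else 0)"
  have N: "N \<in> carrier_mat r r" by (simp add: N_def)
  have "upper_triangular N" by (auto simp: N_def upper_triangular_def)
  then have "det N = prod_list (diag_mat N)" by (rule det_upper_triangular[OF _ N])
  also have "diag_mat N = map (\<lambda>_. 1) [0..<r]"
    by (auto simp: diag_mat_def N_def)
  also have "prod_list \<dots> = 1" by (induction r) auto
  finally have det: "det N = 1" .
  have \<Gamma>c: "\<Gamma> \<in> carrier_mat r r" "det \<Gamma> \<noteq> 0" using \<Gamma> GL_iff_det by auto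
  show "N * \<Gamma> \<in> GL r"
    using det \<Gamma>c det_mult[OF N \<Gamma>c(1)] mult_carrier_mat[OF N \<Gamma>c(1)] by (simp add: GL_iff_det)
  have bf: "base_form \<rho> x s = (\<Sum>j<\<rho>. Const (\<sigma> j) * x j)"
    by (simp add: base_form_sum[OF \<rho>(1)] \<sigma>_def)
  have unshear: "(\<Sum>j<r. Const (N $$ (j, l)) * x' j) = x l" if l: "l < r" for l
  proof (cases "\<rho> \<le> l")
    case True
    have "(\<Sum>j<r. Const (N $$ (j, l)) * x' j) =
        (\<Sum>j<r. (if j = l then x' j else 0) + (if j < \<rho> then Const (\<sigma> j * t l) * x j else 0))"
      using l True by (intro sum.cong) (auto simp: N_def x')
    also have "\<dots> = x' l + (\<Sum>j<r. if j < \<rho> then Const (\<sigma> j * t l) * x j else 0)"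
      using l by (simp add: sum.distrib)
    also have "(\<Sum>j<r. if j < \<rho> then Const (\<sigma> j * t l) * x j else 0) =
        (\<Sum>j<\<rho>. Const (\<sigma> j * t l) * x j)"
      using \<rho> by (intro sum.mono_neutral_cong_right) auto
    also have "\<dots> = Const (t l) * base_form \<rho> x s"
      unfolding bf by (simp add: sum_distrib_left Const_mult mult_ac)
    finally show ?thesis using True by (simp add: x')
  next
    case False
    have "(\<Sum>j<r. Const (N $$ (j, l)) * x' j) = (\<Sum>j<r. if j = l then x j else 0)"
      using l False by (intro sum.cong) (auto simp: N_def x')
    then show ?thesis using l by simp
  qed
  show "new_coordinates r y (N * \<Gamma>) x'"
    unfolding new_coordinates_def
  proof (intro conjI allI impI)
    fix j assume "j < r"
    then have "x j \<in> homog 1" using x by (auto simp: new_coordinates_def)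
    moreover have "Const (- t j) * base_form \<rho> x s \<in> homog 1"
      using homog_mult[OF Const_homog base_form_homog[OF x \<rho>]] by fastforce
    ultimately show "x' j \<in> homog 1"
      using homog_add by (fastforce simp: x' Const_uminus)
  next
    fix i assume i: "i < r"
    have "Var (y i) = (\<Sum>l<r. Const (\<Gamma> $$ (l, i)) * x l)"
      using x i by (simp add: new_coordinates_def)
    also have "\<dots> = (\<Sum>l<r. \<Sum>j<r. Const (N $$ (j, l) * \<Gamma> $$ (l, i)) * x' j)"
      by (intro sum.cong refl, subst unshear[symmetric])
        (simp_all add: sum_distrib_left Const_mult mult_ac)
    also have "\<dots> = (\<Sum>j<r. Const (\<Sum>l<r. N $$ (j, l) * \<Gamma> $$ (l, i)) * x' j)"
      by (subst sum.swap) (simp add: Const_sum sum_distrib_right)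
    also have "\<dots> = (\<Sum>j<r. Const ((N * \<Gamma>) $$ (j, i)) * x' j)"
      using N \<Gamma>c(1) i by (intro sum.cong) (simp_all add: scalar_prod_def atLeast0LessThan)
    finally show "Var (y i) = (\<Sum>j<r. Const ((N * \<Gamma>) $$ (j, i)) * x' j)" .
  qed
qed

section \<open>Lifting relations for generic coordinates\<close>

context graded_mpoly_module
begin

text \<open>
  A lower bound for the rank of the map \<open>(f\<^sub>l)\<^sub>l \<mapsto> \<Sum>\<^sub>l x\<^sub>l f\<^sub>l\<close> on the degree \<open>d\<close> part.
\<close>

definition has_rank :: "nat \<Rightarrow> nat \<Rightarrow> (nat \<Rightarrow> ('v, 'k) mpoly) \<Rightarrow> int \<Rightarrow> nat \<Rightarrow> bool" where
  "has_rank \<rho> r x d n \<longleftrightarrow> (\<exists>v. (\<forall>j i. v j i \<in> gr d) \<and>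
     K.indep_fam n (\<lambda>j. \<Sum>i\<in>{\<rho>..<r}. scale (x i) (v j i)))"

text \<open>
  Each relation \<open>\<Sum>\<^sub>l x\<^sub>l f\<^sub>l = 0\<close> deforms to a relation with coefficients \<open>x\<^sub>l - z \<tau>\<^sub>l b\<close> and
  unknowns \<open>\<Sum>\<^sub>k z\<^sup>k F\<^sub>k\<^sub>,\<^sub>l\<close>, where \<open>b\<close> is \<open>base_form\<close>. The conditions on the \<open>F\<^sub>k\<close> are
  the coefficients of the powers of \<open>z\<close>.
\<close>

definition lifts_relations :: "nat \<Rightarrow> nat \<Rightarrow> (nat \<Rightarrow> ('v, 'k) mpoly) \<Rightarrow> int \<Rightarrow> bool" where
  "lifts_relations \<rho> r x d \<longleftrightarrow> (\<forall>s \<tau> f.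
     (\<forall>i. f i \<in> gr d) \<longrightarrow> (\<Sum>i\<in>{\<rho>..<r}. scale (x i) (f i)) = 0 \<longrightarrow>
     (\<exists>F. F 0 = f \<and> (\<forall>k i. F k i \<in> gr d) \<and>
       (\<forall>k. (\<Sum>i\<in>{\<rho>..<r}. scale (x i) (F (Suc k) i)) =
          scale (base_form \<rho> x s) (\<Sum>i\<in>{\<rho>..<r}. kscale (\<tau> i) (F k i)))))"

lemma lifts_relations_if_maximal_rank:
  assumes inf: "infinite (UNIV :: 'k set)"
    and \<Gamma>: "\<Gamma> \<in> GL r" and x: "new_coordinates r y \<Gamma> x" and \<rho>: "1 \<le> \<rho>" "\<rho> \<le> r"
    and rank: "has_rank \<rho> r x d n"
    and max: "\<And>\<Gamma>' x'. \<Gamma>' \<in> GL r \<Longrightarrow> new_coordinates r y \<Gamma>' x' \<Longrightarrow> \<not> has_rank \<rho> r x' d (Suc n)"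
  shows "lifts_relations \<rho> r x d"
  unfolding lifts_relations_def
proof (intro allI impI)
  fix s \<tau> and f :: "nat \<Rightarrow> 'e"
  assume f: "\<forall>i. f i \<in> gr d" "(\<Sum>i\<in>{\<rho>..<r}. scale (x i) (f i)) = 0"
  let ?b = "base_form \<rho> x s"
  obtain v where v: "\<forall>j i. v j i \<in> gr d" "K.indep_fam n (\<lambda>j. \<Sum>i\<in>{\<rho>..<r}. scale (x i) (v j i))"
    using rank unfolding has_rank_def by blast
  have nrank: "\<not> K.indep_fam (Suc n) (\<lambda>j. \<Sum>i\<in>{\<rho>..<r}.
      scale (x i) (w j i) - kscale z (scale (Const (\<tau> i) * ?b) (w j i)))"
    if w: "\<And>j i. w j i \<in> gr d" for z w
  proof
    assume ind: "K.indep_fam (Suc n) (\<lambda>j. \<Sum>i\<in>{\<rho>..<r}.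
      scale (x i) (w j i) - kscale z (scale (Const (\<tau> i) * ?b) (w j i)))"
    define x' where "x' = (\<lambda>i. if \<rho> \<le> i then x i - Const (z * \<tau> i) * ?b else x i)"
    obtain \<Gamma>' where \<Gamma>': "\<Gamma>' \<in> GL r" "new_coordinates r y \<Gamma>' x'"
      using new_coordinates_shear[OF \<Gamma> x \<rho> x'_def] by blast
    have "(\<Sum>i\<in>{\<rho>..<r}. scale (x i) (w j i) - kscale z (scale (Const (\<tau> i) * ?b) (w j i))) =
        (\<Sum>i\<in>{\<rho>..<r}. scale (x' i) (w j i))" for j
      by (intro sum.cong refl) (simp add: x'_def M.scale_left_diff_distrib Const_mult mult_ac)
    then have "has_rank \<rho> r x' d (Suc n)"
      using ind w unfolding has_rank_def by (intro exI[of _ w]) simp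
    then show False using max[OF \<Gamma>'] by simp
  qed
  obtain F where F: "F 0 = f" "\<forall>k i. F k i \<in> gr d"
    "\<forall>k. (\<Sum>i\<in>{\<rho>..<r}. scale (x i) (F (Suc k) i)) =
        (\<Sum>i\<in>{\<rho>..<r}. scale (Const (\<tau> i) * ?b) (F k i))"
    using K.kernel_lifts_of_maximal_rank[OF inf, of "\<lambda>i. scale (x i)"
        "\<lambda>i. scale (Const (\<tau> i) * ?b)" "gr d" v n "{\<rho>..<r}" f]
      linear_scale subspace_gr v f nrank by blast
  have "(\<Sum>i\<in>{\<rho>..<r}. scale (Const (\<tau> i) * ?b) (F k i)) =
      scale ?b (\<Sum>i\<in>{\<rho>..<r}. kscale (\<tau> i) (F k i))" for k
    by (simp add: M.scale_sum_right mult.commute)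
  then show "\<exists>F. F 0 = f \<and> (\<forall>k i. F k i \<in> gr d) \<and>
       (\<forall>k. (\<Sum>i\<in>{\<rho>..<r}. scale (x i) (F (Suc k) i)) =
          scale ?b (\<Sum>i\<in>{\<rho>..<r}. kscale (\<tau> i) (F k i)))"
    using F by (intro exI[of _ F]) simp
qed

text \<open>
  Take coordinates where the maximal rank \<open>n\<close> is attained, by an independent family of images of tuples
  \<open>v\<^sub>b\<close>, and functionals \<open>\<phi>\<^sub>a\<close> dual to this family. For other coordinates, h is the determinant of
  the values of the \<open>\<phi>\<^sub>a\<close> at the images of the same tuples, scaled by \<open>det \<Gamma>\<close> in order to be a
  polynomial in the entries of \<open>\<Gamma>\<close>.
\<close>

lemma generic_rank:
  fixes x0 :: "nat \<Rightarrow> ('v, 'k) mpoly"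
  assumes \<Gamma>0: "\<Gamma>0 \<in> GL r" "new_coordinates r y \<Gamma>0 x0"
    and T: "finite T" "gr (d + 1) \<subseteq> K.span T"
  shows "\<exists>n h. h \<in> polyfun r \<and> (\<exists>\<Gamma>\<in>carrier_mat r r. h \<Gamma> \<noteq> 0) \<and>
    (\<forall>\<Gamma> x. \<Gamma> \<in> GL r \<longrightarrow> new_coordinates r y \<Gamma> x \<longrightarrow>
       \<not> has_rank \<rho> r x d (Suc n) \<and> (h \<Gamma> \<noteq> 0 \<longrightarrow> has_rank \<rho> r x d n))"
proof -
  define P where "P n \<longleftrightarrow> (\<exists>\<Gamma>\<in>GL r. \<exists>x. new_coordinates r y \<Gamma> x \<and> has_rank \<rho> r x d n)" for n
  have "has_rank \<rho> r x0 d 0"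
    unfolding has_rank_def by (rule exI[of _ "\<lambda>_ _. 0"]) (simp add: K.indep_fam_def)
  then have "P 0" unfolding P_def using \<Gamma>0 by blast
  moreover have bound: "\<forall>n. P n \<longrightarrow> n \<le> card T"
  proof (intro allI impI)
    fix n assume "P n"
    then obtain \<Gamma> x v where x: "new_coordinates r y \<Gamma> x" and v: "\<forall>j i. v j i \<in> gr d"
      and ind: "K.indep_fam n (\<lambda>j. \<Sum>i\<in>{\<rho>..<r}. scale (x i) (v j i))"
      unfolding P_def has_rank_def by blast
    have "(\<Sum>i\<in>{\<rho>..<r}. scale (x i) (v j i)) \<in> gr (d + 1)" for j
      using x v by (intro gr_sum gr_scale[of _ 1]) (auto simp: new_coordinates_def)
    then show "n \<le> card T"
      using T by (intro K.indep_fam_le_card[OF ind]) auto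
  qed
  ultimately have max: "P (GREATEST n. P n)"
    by (intro GreatestI_nat[of P 0 "card T"]) auto
  define n where "n = (GREATEST n. P n)"
  have Pn: "P n" using max by (simp only: n_def)
  have nP: "\<not> P (Suc n)"
    using Greatest_le_nat[of P "Suc n" "card T"] bound unfolding n_def by auto
  obtain \<Gamma>1 x1 v where \<Gamma>1: "\<Gamma>1 \<in> GL r" "new_coordinates r y \<Gamma>1 x1" and v: "\<forall>j i. v j i \<in> gr d"
    and ind: "K.indep_fam n (\<lambda>j. \<Sum>i\<in>{\<rho>..<r}. scale (x1 i) (v j i))"
    using Pn unfolding P_def has_rank_def by blast
  obtain \<phi> where lin: "\<And>i. Vector_Spaces.linear kscale (*) (\<phi> i)"
    and dual: "\<forall>a<n. \<forall>b<n. \<phi> a (\<Sum>i\<in>{\<rho>..<r}. scale (x1 i) (v b i)) = (if a = b then 1 else 0)"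
    using K.indep_fam_dual[OF ind] by blast
  define H where "H \<Gamma> a b = (\<Sum>i\<in>{\<rho>..<r}. \<Sum>m<r. adj_mat \<Gamma> $$ (m, i) * \<phi> a (scale (Var (y m)) (v b i)))"
    for \<Gamma> :: "'k mat" and a b
  have H: "H \<Gamma> a b = \<phi> a (\<Sum>i\<in>{\<rho>..<r}. scale (x i) (kscale (det \<Gamma>) (v b i)))"
    if \<Gamma>: "\<Gamma> \<in> GL r" and x: "new_coordinates r y \<Gamma> x" for \<Gamma> x a b
  proof -
    have "scale (x i) (kscale (det \<Gamma>) (v b i)) =
        (\<Sum>m<r. kscale (adj_mat \<Gamma> $$ (m, i)) (scale (Var (y m)) (v b i)))" if "i < r" for i
    proof -
      have "scale (x i) (kscale (det \<Gamma>) (v b i)) = scale (Const (det \<Gamma>) * x i) (v b i)"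
        by (simp add: mult.commute)
      also have "\<dots> = (\<Sum>m<r. kscale (adj_mat \<Gamma> $$ (m, i)) (scale (Var (y m)) (v b i)))"
        using \<Gamma> that by (subst new_coordinates_adj[OF _ x]) (simp_all add: GL_iff_det M.scale_sum_left)
      finally show ?thesis .
    qed
    then have expand: "(\<Sum>i\<in>{\<rho>..<r}. scale (x i) (kscale (det \<Gamma>) (v b i))) =
       (\<Sum>i\<in>{\<rho>..<r}. \<Sum>m<r. kscale (adj_mat \<Gamma> $$ (m, i)) (scale (Var (y m)) (v b i)))"
      by (intro sum.cong) auto
    interpret \<phi>: Vector_Spaces.linear kscale "(*)" "\<phi> a" by (rule lin)
    show ?thesis unfolding expand H_def by (simp add: \<phi>.sum \<phi>.scale del: M.scale_scale)
  qed
  obtain ad where ad: "\<And>m i. m < r \<Longrightarrow> i < r \<Longrightarrow> ad m i \<in> polyfun r"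
    "\<And>m i (A :: 'k mat). m < r \<Longrightarrow> i < r \<Longrightarrow> A \<in> carrier_mat r r \<Longrightarrow> ad m i A = adj_mat A $$ (m, i)"
    using polyfun_adj_mat[where 'a = 'k and r = r] by metis
  define h where "h \<Gamma> = det (mat n n (\<lambda>(a, b). \<Sum>i\<in>{\<rho>..<r}. \<Sum>m<r.
      ad m i \<Gamma> * \<phi> a (scale (Var (y m)) (v b i))))" for \<Gamma>
  have h_poly: "h \<in> polyfun r"
    unfolding h_def[abs_def]
    by (intro polyfun_det polyfun_sum polyfun_mult polyfun_const ad) auto
  have h: "h \<Gamma> = det (mat n n (\<lambda>(a, b). H \<Gamma> a b))" if "\<Gamma> \<in> GL r" for \<Gamma>
    unfolding h_def H_def using that by (simp add: GL_iff_det ad(2))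
  have h_nonzero: "h \<Gamma>1 \<noteq> 0"
  proof -
    have "H \<Gamma>1 a b = (if a = b then det \<Gamma>1 else 0)" if "a < n" "b < n" for a b
    proof -
      interpret \<phi>: Vector_Spaces.linear kscale "(*)" "\<phi> a" by (rule lin)
      have "(\<Sum>i\<in>{\<rho>..<r}. scale (x1 i) (kscale (det \<Gamma>1) (v b i))) =
          kscale (det \<Gamma>1) (\<Sum>i\<in>{\<rho>..<r}. scale (x1 i) (v b i))"
        by (simp add: M.scale_sum_right mult.commute)
      then show ?thesis
        using dual that by (simp add: H[OF \<Gamma>1] \<phi>.scale)
    qed
    then have "mat n n (\<lambda>(a, b). H \<Gamma>1 a b) = det \<Gamma>1 \<cdot>\<^sub>m 1\<^sub>m n"
      by (intro eq_matI) auto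
    then show ?thesis using \<Gamma>1(1) by (simp add: h GL_iff_det)
  qed
  have rank: "has_rank \<rho> r x d n" if \<Gamma>: "\<Gamma> \<in> GL r" "new_coordinates r y \<Gamma> x" "h \<Gamma> \<noteq> 0" for \<Gamma> x
  proof -
    have "det (mat n n (\<lambda>(a, b). \<phi> a (\<Sum>i\<in>{\<rho>..<r}. scale (x i) (kscale (det \<Gamma>) (v b i))))) \<noteq> 0"
      using \<Gamma> h H[OF \<Gamma>(1,2)] by simp
    then have "K.indep_fam n (\<lambda>b. \<Sum>i\<in>{\<rho>..<r}. scale (x i) (kscale (det \<Gamma>) (v b i)))"
      by (rule K.indep_fam_if_det[OF lin])
    then show ?thesis
      unfolding has_rank_def using v by (intro exI[of _ "\<lambda>b i. kscale (det \<Gamma>) (v b i)"]) (simp add: gr_kscale)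
  qed
  have max_rank: "\<not> has_rank \<rho> r x d (Suc n)" if "\<Gamma> \<in> GL r" "new_coordinates r y \<Gamma> x" for \<Gamma> x
    using nP that unfolding P_def by blast
  have "\<exists>\<Gamma>\<in>carrier_mat r r. h \<Gamma> \<noteq> 0"
    using \<Gamma>1(1) h_nonzero unfolding GL_iff_det by blast
  then show ?thesis
    by (intro exI[of _ n] exI[of _ h] conjI allI impI h_poly max_rank rank)
qed

definition generates_next :: "nat \<Rightarrow> nat \<Rightarrow> (nat \<Rightarrow> ('v, 'k) mpoly) \<Rightarrow> int \<Rightarrow> bool" where
  "generates_next \<rho> r x d \<longleftrightarrow>
     (\<forall>u\<in>gr (d + 1). \<exists>g. (\<forall>l. g l \<in> gr d) \<and> u = (\<Sum>l\<in>{\<rho>..<r}. scale (x l) (g l)))"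

text \<open>
  If the map \<open>(f\<^sub>l)\<^sub>l \<mapsto> \<Sum>\<^sub>l x\<^sub>l f\<^sub>l\<close> is onto, the conditions can be solved one after the other.
\<close>

lemma lifts_relations_if_generates_next:
  assumes x: "new_coordinates r y \<Gamma> x" and \<rho>: "1 \<le> \<rho>" "\<rho> \<le> r"
    and surj: "generates_next \<rho> r x d"
  shows "lifts_relations \<rho> r x d"
  unfolding lifts_relations_def
proof (intro allI impI)
  fix s \<tau> and f :: "nat \<Rightarrow> 'e"
  assume f: "\<forall>i. f i \<in> gr d"
  obtain pick where pick: "\<And>u l. u \<in> gr (d + 1) \<Longrightarrow> pick u l \<in> gr d"
    "\<And>u. u \<in> gr (d + 1) \<Longrightarrow> (\<Sum>l\<in>{\<rho>..<r}. scale (x l) (pick u l)) = u"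
    using surj unfolding generates_next_def by metis
  define step where "step g = scale (base_form \<rho> x s) (\<Sum>i\<in>{\<rho>..<r}. kscale (\<tau> i) (g i))"
    for g :: "nat \<Rightarrow> 'e"
  define F where "F = rec_nat f (\<lambda>_ g. pick (step g))"
  have F: "F 0 = f" "F (Suc k) = pick (step (F k))" for k by (simp_all add: F_def)
  have step: "step g \<in> gr (d + 1)" if "\<forall>i. g i \<in> gr d" for g
    unfolding step_def using that
    by (intro gr_scale[OF base_form_homog[OF x \<rho>]] gr_sum gr_kscale) auto
  have gr: "\<forall>i. F k i \<in> gr d" for k
    by (induction k) (simp_all add: f step pick(1) F)
  have "(\<Sum>i\<in>{\<rho>..<r}. scale (x i) (F (Suc k) i)) = step (F k)" for k
    unfolding F(2) by (rule pick(2)[OF step[OF gr]])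
  then show "\<exists>F. F 0 = f \<and> (\<forall>k i. F k i \<in> gr d) \<and>
       (\<forall>k. (\<Sum>i\<in>{\<rho>..<r}. scale (x i) (F (Suc k) i)) =
          scale (base_form \<rho> x s) (\<Sum>i\<in>{\<rho>..<r}. kscale (\<tau> i) (F k i)))"
    using F(1) gr unfolding step_def by blast
qed

text \<open>
  With \<open>E\<^sub>d\<close> the degree \<open>d\<close> part, and \<open>L\<close>, \<open>L\<^sub>0\<close> the spans of the forms from the two systems:
  \<open>E\<^sub>d\<^sub>+\<^sub>2 = L\<^sub>0 E\<^sub>d\<^sub>+\<^sub>1 = L\<^sub>0 L E\<^sub>d \<subseteq> L E\<^sub>d\<^sub>+\<^sub>1\<close>.
\<close>

lemma generates_next_propagates:
  assumes x: "new_coordinates r y \<Gamma> x" and x0: "new_coordinates r y \<Gamma>0 x0"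
    and d: "generates_next \<rho> r x d" and d0: "generates_next \<rho> r x0 (d + 1)"
  shows "generates_next \<rho> r x (d + 1)"
  unfolding generates_next_def
proof
  fix u assume "u \<in> gr (d + 1 + 1)"
  then obtain g where g: "\<forall>l. g l \<in> gr (d + 1)" "u = (\<Sum>l\<in>{\<rho>..<r}. scale (x0 l) (g l))"
    using d0 unfolding generates_next_def by blast
  have "\<forall>l. \<exists>h. (\<forall>m. h m \<in> gr d) \<and> g l = (\<Sum>m\<in>{\<rho>..<r}. scale (x m) (h m))"
    using d g(1) unfolding generates_next_def by simp
  from choice[OF this] obtain h where
    "\<forall>l. (\<forall>m. h l m \<in> gr d) \<and> g l = (\<Sum>m\<in>{\<rho>..<r}. scale (x m) (h l m))" ..
  then have h: "h l m \<in> gr d" "g l = (\<Sum>m\<in>{\<rho>..<r}. scale (x m) (h l m))" for l m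
    by simp_all
  have "u = (\<Sum>l\<in>{\<rho>..<r}. \<Sum>m\<in>{\<rho>..<r}. scale (x m) (scale (x0 l) (h l m)))"
    unfolding g(2) by (subst h(2)) (simp add: M.scale_sum_right mult.commute)
  also have "\<dots> = (\<Sum>m\<in>{\<rho>..<r}. scale (x m) (\<Sum>l\<in>{\<rho>..<r}. scale (x0 l) (h l m)))"
    by (subst sum.swap) (simp add: M.scale_sum_right)
  finally have "u = (\<Sum>m\<in>{\<rho>..<r}. scale (x m) (\<Sum>l\<in>{\<rho>..<r}. scale (x0 l) (h l m)))" .
  moreover have "(\<Sum>l\<in>{\<rho>..<r}. scale (x0 l) (h l m)) \<in> gr (d + 1)" for m
    using x0 h(1) by (intro gr_sum gr_scale[of _ 1]) (auto simp: new_coordinates_def)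
  ultimately show "\<exists>g. (\<forall>l. g l \<in> gr (d + 1)) \<and> u = (\<Sum>l\<in>{\<rho>..<r}. scale (x l) (g l))"
    by (intro exI[of _ "\<lambda>m. \<Sum>l\<in>{\<rho>..<r}. scale (x0 l) (h l m)"]) simp
qed

text \<open>
  In the coordinates \<open>x0\<close> the image is the whole next degree part, so its dimension is at most n; in
  the coordinates \<open>x\<close> the image has at least this dimension.
\<close>

lemma generates_next_if_rank:
  assumes x: "new_coordinates r y \<Gamma> x"
    and rank: "has_rank \<rho> r x d n" and x0: "generates_next \<rho> r x0 d" "\<not> has_rank \<rho> r x0 d (Suc n)"
  shows "generates_next \<rho> r x d"
  unfolding generates_next_def
proof
  fix u assume u: "u \<in> gr (d + 1)"
  obtain v where v: "\<forall>j i. v j i \<in> gr d" "K.indep_fam n (\<lambda>j. \<Sum>i\<in>{\<rho>..<r}. scale (x i) (v j i))"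
    using rank unfolding has_rank_def by blast
  define w where "w j = (\<Sum>i\<in>{\<rho>..<r}. scale (x i) (v j i))" for j
  have ind: "K.indep_fam n w" using v(2) by (simp add: w_def[abs_def])
  have w: "w j \<in> gr (d + 1)" for j
    unfolding w_def using x v by (intro gr_sum gr_scale[of _ 1]) (auto simp: new_coordinates_def)
  have "u \<in> K.span (w ` {..<n})"
  proof (rule ccontr)
    assume "u \<notin> K.span (w ` {..<n})"
    then have ind': "K.indep_fam (Suc n) (\<lambda>j. if j < n then w j else u)"
      by (rule K.indep_fam_extend[OF ind])
    have "\<forall>j. (if j < n then w j else u) \<in> gr (d + 1)" using w u by simp
    then have "\<forall>j. \<exists>g. (\<forall>l. g l \<in> gr d) \<and>
        (if j < n then w j else u) = (\<Sum>l\<in>{\<rho>..<r}. scale (x0 l) (g l))"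
      using x0(1) unfolding generates_next_def by blast
    from choice[OF this] obtain g where "\<forall>j. (\<forall>l. g j l \<in> gr d) \<and>
        (if j < n then w j else u) = (\<Sum>l\<in>{\<rho>..<r}. scale (x0 l) (g j l))" ..
    then have "has_rank \<rho> r x0 d (Suc n)"
      using ind' unfolding has_rank_def by (intro exI[of _ g]) simp
    then show False using x0(2) by simp
  qed
  moreover define L where "L = {u. \<exists>g. (\<forall>l. g l \<in> gr d) \<and> u = (\<Sum>l\<in>{\<rho>..<r}. scale (x l) (g l))}"
  have "K.subspace L"
  proof (rule K.subspaceI)
    show "0 \<in> L" unfolding L_def mem_Collect_eq by (intro exI[of _ "\<lambda>_. 0"]) simp
  next
    fix a b assume "a \<in> L" "b \<in> L"
    then obtain g h where "\<forall>l. g l \<in> gr d" "a = (\<Sum>l\<in>{\<rho>..<r}. scale (x l) (g l))"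
      "\<forall>l. h l \<in> gr d" "b = (\<Sum>l\<in>{\<rho>..<r}. scale (x l) (h l))" unfolding L_def by blast
    then show "a + b \<in> L" unfolding L_def mem_Collect_eq
      by (intro exI[of _ "\<lambda>l. g l + h l"]) (simp add: M.scale_right_distrib sum.distrib gr_add)
  next
    fix c a assume "a \<in> L"
    then obtain g where "\<forall>l. g l \<in> gr d" "a = (\<Sum>l\<in>{\<rho>..<r}. scale (x l) (g l))"
      unfolding L_def by blast
    then show "kscale c a \<in> L" unfolding L_def mem_Collect_eq
      by (intro exI[of _ "\<lambda>l. kscale c (g l)"]) (simp add: M.scale_sum_right gr_kscale mult.commute)
  qed
  moreover have "w ` {..<n} \<subseteq> L" using v(1) unfolding L_def w_def by blast
  ultimately have "u \<in> L" using K.span_minimal by blast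
  then show "\<exists>g. (\<forall>l. g l \<in> gr d) \<and> u = (\<Sum>l\<in>{\<rho>..<r}. scale (x l) (g l))"
    unfolding L_def by blast
qed

text \<open>
  A bound \<open>b\<close> for the absolute values of the twists leaves finitely many degrees in which the rank has to
  be controlled by a polynomial; in degree \<open>b\<close> this control yields surjectivity, which then holds in all
  higher degrees.
\<close>

theorem generic_coordinates_lift_relations:
  assumes inf: "infinite (UNIV :: 'k set)"
    and \<Gamma>0: "\<Gamma>0 \<in> GL r" "new_coordinates r y \<Gamma>0 x0" and \<rho>: "1 \<le> \<rho>" "\<rho> \<le> r"
    and gen: "generated_by (adjoin (x0 ` {\<rho>..<r})) Q \<kappa> e"
  shows "\<exists>U. zariski_open_GL r U \<and> U \<noteq> {} \<and>
    (\<forall>\<Gamma>\<in>U. \<forall>x. new_coordinates r y \<Gamma> x \<longrightarrow> (\<forall>d. lifts_relations \<rho> r x d))"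
proof -
  have X0: "x0 ` {\<rho>..<r} \<subseteq> homog 1" using \<Gamma>0(2) by (auto simp: new_coordinates_def)
  define b where "b = (\<Sum>i<Q. \<bar>\<kappa> i\<bar>)"
  have b: "\<bar>\<kappa> i\<bar> \<le> b" if "i < Q" for i
    unfolding b_def using that by (intro member_le_sum) auto
  have "\<forall>d. \<exists>n h. h \<in> polyfun r \<and> (\<exists>\<Gamma>\<in>carrier_mat r r. h \<Gamma> \<noteq> 0) \<and>
    (\<forall>\<Gamma> x. \<Gamma> \<in> GL r \<longrightarrow> new_coordinates r y \<Gamma> x \<longrightarrow>
       \<not> has_rank \<rho> r x d (Suc n) \<and> (h \<Gamma> \<noteq> 0 \<longrightarrow> has_rank \<rho> r x d n))"
  proof
    fix d
    obtain T where "finite T" "gr (d + 1) \<subseteq> K.span T"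
      using gr_finite_dimensional[OF gen X0, of "d + 1"] by (elim exE conjE)
    then show "\<exists>n h. h \<in> polyfun r \<and> (\<exists>\<Gamma>\<in>carrier_mat r r. h \<Gamma> \<noteq> 0) \<and>
      (\<forall>\<Gamma> x. \<Gamma> \<in> GL r \<longrightarrow> new_coordinates r y \<Gamma> x \<longrightarrow>
         \<not> has_rank \<rho> r x d (Suc n) \<and> (h \<Gamma> \<noteq> 0 \<longrightarrow> has_rank \<rho> r x d n))"
      by (rule generic_rank[OF \<Gamma>0])
  qed
  from choice[OF this] obtain n where "\<forall>d. \<exists>h. h \<in> polyfun r \<and> (\<exists>\<Gamma>\<in>carrier_mat r r. h \<Gamma> \<noteq> 0) \<and>
    (\<forall>\<Gamma> x. \<Gamma> \<in> GL r \<longrightarrow> new_coordinates r y \<Gamma> x \<longrightarrow>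
       \<not> has_rank \<rho> r x d (Suc (n d)) \<and> (h \<Gamma> \<noteq> 0 \<longrightarrow> has_rank \<rho> r x d (n d)))" ..
  from choice[OF this] obtain h where nh: "\<forall>d. h d \<in> polyfun r \<and> (\<exists>\<Gamma>\<in>carrier_mat r r. h d \<Gamma> \<noteq> 0) \<and>
    (\<forall>\<Gamma> x. \<Gamma> \<in> GL r \<longrightarrow> new_coordinates r y \<Gamma> x \<longrightarrow>
       \<not> has_rank \<rho> r x d (Suc (n d)) \<and> (h d \<Gamma> \<noteq> 0 \<longrightarrow> has_rank \<rho> r x d (n d)))" ..
  have h: "h d \<in> polyfun r" "\<exists>\<Gamma>\<in>carrier_mat r r. h d \<Gamma> \<noteq> 0" for d
    using nh by simp_all
  have max: "\<not> has_rank \<rho> r x d (Suc (n d))"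
    if "\<Gamma> \<in> GL r" "new_coordinates r y \<Gamma> x" for d \<Gamma> x
    using nh that by simp
  have rank: "has_rank \<rho> r x d (n d)"
    if "\<Gamma> \<in> GL r" "new_coordinates r y \<Gamma> x" "h d \<Gamma> \<noteq> 0" for d \<Gamma> x
    using nh that by simp
  obtain D where D: "D \<in> polyfun r" "\<forall>A\<in>carrier_mat r r. D A = (det A :: 'k)"
    using polyfun_det_matrix[of r, where 'a = 'k] by (elim bexE)
  have "\<exists>A\<in>carrier_mat r r. \<forall>F\<in>insert D (h ` {-b..b}). F A \<noteq> 0"
  proof (rule polyfun_common_nonzero[OF inf])
    fix F assume "F \<in> insert D (h ` {-b..b})"
    then consider "F = D" | d where "F = h d" by blast
    then show "F \<in> polyfun r \<and> (\<exists>A\<in>carrier_mat r r. F A \<noteq> 0)"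
    proof cases
      case 1
      have "D (1\<^sub>m r) \<noteq> 0" using D(2) by simp
      then show ?thesis using D(1) 1 by (intro conjI bexI[of _ "1\<^sub>m r"]) simp_all
    next
      case 2
      then show ?thesis using h[of d] by simp
    qed
  qed simp
  then obtain A where A: "A \<in> carrier_mat r r" "D A \<noteq> 0" "\<forall>d\<in>{-b..b}. h d A \<noteq> 0" by auto
  have "(\<lambda>\<Gamma>. \<Prod>d\<in>{-b..b}. h d \<Gamma>) \<in> polyfun r" by (intro polyfun_prod h)
  then obtain f where f: "entry_poly r f"
    "(\<lambda>\<Gamma>. \<Prod>d\<in>{-b..b}. h d \<Gamma>) = (\<lambda>\<Gamma>. eval_mpoly (\<lambda>ij. \<Gamma> $$ ij) f)"
    by (rule polyfunE)
  have f_eq: "eval_mpoly (\<lambda>ij. \<Gamma> $$ ij) f = (\<Prod>d\<in>{-b..b}. h d \<Gamma>)" for \<Gamma>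
    using fun_cong[OF f(2), of \<Gamma>] by simp
  define U where "U = {\<Gamma> \<in> GL r. \<exists>f\<in>{f}. eval_mpoly (\<lambda>ij. \<Gamma> $$ ij) f \<noteq> 0}"
  have "zariski_open_GL r U"
    unfolding zariski_open_GL_def U_def using f(1) unfolding entry_poly_def
    by (intro exI[of _ "{f}"] conjI refl) simp
  moreover have "A \<in> U"
    using A D(2) by (simp add: U_def GL_iff_det f_eq)
  moreover have "lifts_relations \<rho> r x d"
    if \<Gamma>U: "\<Gamma> \<in> U" and x: "new_coordinates r y \<Gamma> x" for \<Gamma> x d
  proof -
    have \<Gamma>: "\<Gamma> \<in> GL r" "\<And>d. d \<in> {-b..b} \<Longrightarrow> h d \<Gamma> \<noteq> 0"
      using \<Gamma>U by (auto simp: U_def f_eq)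
    consider "d < -b" | "d \<in> {-b..b}" | "b \<le> d" by force
    then show ?thesis
    proof cases
      case 1
      have zero: "u = 0" if "u \<in> gr d" for u
        by (rule gr_eq_0_below_generators[OF gen X0 _ that]) (use b 1 in force)
      show ?thesis
        unfolding lifts_relations_def
      proof (intro allI impI)
        fix s \<tau> and f :: "nat \<Rightarrow> 'e"
        assume "\<forall>i. f i \<in> gr d"
        then have "f = (\<lambda>_. 0)" using zero by (intro ext) simp
        then show "\<exists>F. F 0 = f \<and> (\<forall>k i. F k i \<in> gr d) \<and>
          (\<forall>k. (\<Sum>i\<in>{\<rho>..<r}. scale (x i) (F (Suc k) i)) =
            scale (base_form \<rho> x s) (\<Sum>i\<in>{\<rho>..<r}. kscale (\<tau> i) (F k i)))"
          by (intro exI[of _ "\<lambda>_. f"]) simp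
      qed
    next
      case 2
      then show ?thesis
        by (intro lifts_relations_if_maximal_rank[OF inf \<Gamma>(1) x \<rho> rank[OF \<Gamma>(1) x \<Gamma>(2)] max])
    next
      case 3
      have x0: "generates_next \<rho> r x0 d" if "b \<le> d" for d
        unfolding generates_next_def
      proof
        fix u assume u: "u \<in> gr (d + 1)"
        show "\<exists>g. (\<forall>l. g l \<in> gr d) \<and> u = (\<Sum>l\<in>{\<rho>..<r}. scale (x0 l) (g l))"
          by (rule gr_Suc_above_generators[OF gen X0 _ _ u]) (use b that in force)+
      qed
      have "b \<ge> 0" unfolding b_def by (simp add: sum_nonneg)
      have "generates_next \<rho> r x d"
        using 3
      proof (induction d rule: int_ge_induct)
        case base
        show ?case
          using generates_next_if_rank[OF x rank[OF \<Gamma>(1) x \<Gamma>(2)] x0 max[OF \<Gamma>0]] \<open>b \<ge> 0\<close> by simp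
      next
        case (step d)
        then show ?case using generates_next_propagates[OF x \<Gamma>0(2)] x0 by simp
      qed
      then show ?thesis by (rule lifts_relations_if_generates_next[OF x \<rho>])
    qed
  qed
  ultimately show ?thesis by (intro exI[of _ U] conjI ballI allI impI) auto
qed

end

section \<open>Relations of low degree\<close>

lemma mult_mat_vec_entry:
  assumes "B \<in> carrier_mat n n" "v \<in> carrier_vec n" "i < n"
  shows "(B *\<^sub>v v) $ i = (\<Sum>j<n. B $$ (i, j) * v $ j)"
  using assms by (simp add: scalar_prod_def atLeast0LessThan)

context graded_mpoly_module
begin

lemma hom_from_free_combination:
  assumes hom: "module_hom_from_free scale gr (adjoin G) Q \<kappa> \<pi>" and v: "v \<in> free_mod (adjoin G) Q"
  shows "\<pi> v = (\<Sum>i<Q. scale (v $ i) (\<pi> (unit_vec Q i)))"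
proof -
  have vd: "v \<in> carrier_vec Q" "\<And>i. i < Q \<Longrightarrow> v $ i \<in> adjoin G" using v by (auto simp: free_mod_def)
  have add: "\<pi> (u + w) = \<pi> u + \<pi> w" if "u \<in> free_mod (adjoin G) Q" "w \<in> free_mod (adjoin G) Q" for u w
    using hom that by (simp add: module_hom_from_free_def)
  have smult: "\<pi> (a \<cdot>\<^sub>v u) = scale a (\<pi> u)" if "a \<in> adjoin G" "u \<in> free_mod (adjoin G) Q" for a u
    using hom that by (simp add: module_hom_from_free_def)
  let ?w = "\<lambda>n. vec Q (\<lambda>i. if i < n then v $ i else 0)"
  have "\<pi> (?w n) = (\<Sum>i<n. scale (v $ i) (\<pi> (unit_vec Q i)))" if "n \<le> Q" for n
    using that
  proof (induction n)
    case 0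
    have "?w 0 = 0 \<cdot>\<^sub>v v" using vd by (intro eq_vecI) auto
    then show ?case using smult[OF adjoin_0 v] by simp
  next
    case (Suc n)
    have "?w (Suc n) = ?w n + v $ n \<cdot>\<^sub>v unit_vec Q n"
      using Suc.prems by (intro eq_vecI) (auto simp: less_Suc_eq)
    moreover have "?w n \<in> free_mod (adjoin G) Q" "unit_vec Q n \<in> free_mod (adjoin G) Q"
      "v $ n \<cdot>\<^sub>v unit_vec Q n \<in> free_mod (adjoin G) Q"
      using vd(2) Suc.prems by (auto simp: free_mod_def)
    ultimately show ?case using Suc vd(2) by (simp add: add smult)
  qed
  from this[of Q] have "\<pi> (?w Q) = (\<Sum>i<Q. scale (v $ i) (\<pi> (unit_vec Q i)))" by simp
  moreover have "?w Q = v" using vd by (intro eq_vecI) auto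
  ultimately show ?thesis by simp
qed

lemma hom_from_free_generates:
  assumes hom: "module_hom_from_free scale gr (adjoin G) Q \<kappa> \<pi>"
    and surj: "\<pi> ` free_mod (adjoin G) Q = UNIV"
  shows "generated_by (adjoin G) Q \<kappa> (\<lambda>i. \<pi> (unit_vec Q i))"
  unfolding generated_by_def
proof (intro conjI allI impI)
  fix i assume "i < Q"
  have one: "(1 :: ('v, 'k) mpoly) \<in> homog 0" by (metis Const_1 Const_homog)
  have "unit_vec Q i \<in> free_deg (adjoin G) Q \<kappa> (- \<kappa> i)"
    unfolding free_deg_def free_mod_def using \<open>i < Q\<close> one by (auto simp: unit_vec_def)
  then show "\<pi> (unit_vec Q i) \<in> gr (- \<kappa> i)"
    using hom by (simp add: module_hom_from_free_def)
next
  fix u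
  have "u \<in> \<pi> ` free_mod (adjoin G) Q" using surj by simp
  then obtain v where v: "v \<in> free_mod (adjoin G) Q" "u = \<pi> v" by blast
  then have "u = (\<Sum>i<Q. scale (v $ i) (\<pi> (unit_vec Q i)))"
    using hom_from_free_combination[OF hom] by simp
  then show "\<exists>v. (\<forall>i<Q. v i \<in> adjoin G) \<and> u = (\<Sum>i<Q. scale (v i) (\<pi> (unit_vec Q i)))"
    using v(1) by (intro exI[of _ "\<lambda>i. v $ i"]) (simp add: free_mod_def)
qed

end

text \<open>
  The setting after the choice of coordinates: \<open>Rel d\<close> is the degree \<open>d\<close> part of the
  kernel of \<open>\<pi>\<close>, and genericity of the coordinates enters through \<open>lifts\<close>.
\<close>

locale relations_in_generic_coordinates = graded_mpoly_module scale gr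
  for scale :: "('v::finite, 'k::field) mpoly \<Rightarrow> 'e::ab_group_add \<Rightarrow> 'e" and gr +
  fixes \<rho> r Q p :: nat and x :: "nat \<Rightarrow> ('v, 'k) mpoly" and \<kappa> :: "nat \<Rightarrow> int"
    and \<pi> :: "('v, 'k) mpoly vec \<Rightarrow> 'e" and W :: "('v, 'k) mpoly mat" and s :: "nat \<Rightarrow> 'k"
    and A :: "('v, 'k) mpoly set" and Rel :: "int \<Rightarrow> ('v, 'k) mpoly vec set"
  assumes infinite_field: "infinite (UNIV :: 'k set)"
    and A: "A = adjoin (x ` {\<rho>..<r})"
    and linear_forms: "x ` {\<rho>..<r} \<subseteq> homog 1"
    and hom: "module_hom_from_free scale gr A Q \<kappa> \<pi>"
    and surj: "\<pi> ` free_mod A Q = UNIV"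
    and Rel: "Rel d = {u \<in> free_deg A Q \<kappa> d. \<pi> u = 0}"
    and minimal: "u \<in> Rel d \<Longrightarrow> i < Q \<Longrightarrow> Poly_Mapping.lookup (u $ i) 0 = 0"
    and W_carrier: "W \<in> carrier_mat Q Q"
    and W_entries: "i < Q \<Longrightarrow> j < Q \<Longrightarrow> W $$ (i, j) \<in> A"
    and W_degree: "v \<in> free_deg A Q \<kappa> (d - 1) \<Longrightarrow> W *\<^sub>v v \<in> free_deg A Q \<kappa> d"
    and W_mult: "v \<in> free_mod A Q \<Longrightarrow> \<pi> (W *\<^sub>v v) = scale (base_form \<rho> x s) (\<pi> v)"
    and lifts: "lifts_relations \<rho> r x d"
    and ordered: "i < p \<Longrightarrow> \<kappa> i \<le> \<kappa> (p - 1)" and p_le: "p \<le> Q"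
begin

lemma free_deg_D:
  assumes "v \<in> free_deg A Q \<kappa> d"
  shows "v \<in> carrier_vec Q" "dim_vec v = Q" "v \<in> free_mod A Q"
    "\<And>i. i < Q \<Longrightarrow> v $ i \<in> A" "\<And>i. i < Q \<Longrightarrow> v $ i \<in> homog (d + \<kappa> i)"
  using assms by (auto simp: free_deg_def free_mod_def)

lemma hom_combination: "v \<in> free_mod A Q \<Longrightarrow> \<pi> v = (\<Sum>i<Q. scale (v $ i) (\<pi> (unit_vec Q i)))"
  using hom_from_free_combination hom unfolding A by blast

lemma hom_vec_sum:
  assumes "\<And>l. l \<in> L \<Longrightarrow> c l \<in> A" "\<And>l. l \<in> L \<Longrightarrow> z l \<in> free_mod A Q"
  shows "vec Q (\<lambda>i. \<Sum>l\<in>L. c l * z l $ i) \<in> free_mod A Q"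
    and "\<pi> (vec Q (\<lambda>i. \<Sum>l\<in>L. c l * z l $ i)) = (\<Sum>l\<in>L. scale (c l) (\<pi> (z l)))"
proof -
  show v: "vec Q (\<lambda>i. \<Sum>l\<in>L. c l * z l $ i) \<in> free_mod A Q"
    using assms unfolding A free_mod_def by (auto intro!: adjoin_sum adjoin.mult)
  have "(\<Sum>l\<in>L. scale (c l) (\<pi> (z l))) = (\<Sum>l\<in>L. \<Sum>i<Q. scale (c l * z l $ i) (\<pi> (unit_vec Q i)))"
    using hom_combination[OF assms(2)] by (simp add: M.scale_sum_right)
  also have "\<dots> = (\<Sum>i<Q. scale (\<Sum>l\<in>L. c l * z l $ i) (\<pi> (unit_vec Q i)))"
    by (subst sum.swap) (simp add: M.scale_sum_left)
  finally show "\<pi> (vec Q (\<lambda>i. \<Sum>l\<in>L. c l * z l $ i)) = (\<Sum>l\<in>L. scale (c l) (\<pi> (z l)))"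
    using hom_combination[OF v] by simp
qed

lemma hom_surj_deg:
  assumes "u \<in> gr d" shows "\<exists>v\<in>free_deg A Q \<kappa> d. \<pi> v = u"
proof -
  have "generated_by A Q \<kappa> (\<lambda>i. \<pi> (unit_vec Q i))"
    using hom_from_free_generates hom surj unfolding A by blast
  then obtain v where v: "\<forall>i<Q. v i \<in> A \<inter> homog (d + \<kappa> i)" "u = (\<Sum>i<Q. scale (v i) (\<pi> (unit_vec Q i)))"
    using generated_by_homogeneous[OF _ linear_forms assms] unfolding A by blast
  have "vec Q v \<in> free_deg A Q \<kappa> d" using v(1) by (auto simp: free_deg_def free_mod_def)
  moreover from this have "\<pi> (vec Q v) = u"
    using hom_combination[OF free_deg_D(3)] v(2) by simp
  ultimately show ?thesis by blast
qed

text \<open>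
  Entries of negative degree vanish, and entries of degree 0 are constants, which minimality excludes.
\<close>

lemma low_relation_first_zero:
  assumes "u \<in> Rel d" "d \<le> - \<kappa> (p - 1)" "i < p"
  shows "u $ i = 0"
proof -
  have i: "i < Q" using assms(3) p_le by simp
  then have u: "u $ i \<in> homog (d + \<kappa> i)" "Poly_Mapping.lookup (u $ i) 0 = 0"
    using assms(1) minimal free_deg_D(5) unfolding Rel by auto
  have "d + \<kappa> i \<le> 0" using assms(2) ordered[OF assms(3)] by simp
  then consider "d + \<kappa> i < 0" | "d + \<kappa> i = 0" by linarith
  then show ?thesis
    by cases (use u homog_neg_eq_0 homog_0_eq_0 in auto)
qed

lemma lower_degree_first_zero:
  assumes "v \<in> free_deg A Q \<kappa> (d - 1)" "d \<le> - \<kappa> (p - 1)" "i < p"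
  shows "v $ i = 0"
proof (rule homog_neg_eq_0)
  show "v $ i \<in> homog (d - 1 + \<kappa> i)" using assms(3) p_le by (intro free_deg_D(5)[OF assms(1)]) simp
  show "d - 1 + \<kappa> i < 0" using assms(2) ordered[OF assms(3)] by simp
qed

lemma relation_split:
  assumes u: "u \<in> Rel d"
  shows "\<exists>w. (\<forall>l. w l \<in> free_deg A Q \<kappa> (d - 1)) \<and>
    u = vec Q (\<lambda>i. \<Sum>l\<in>{\<rho>..<r}. x l * w l $ i)"
proof -
  have ud: "u \<in> free_deg A Q \<kappa> d" using u by (simp add: Rel)
  have "\<forall>i. \<exists>g. i < Q \<longrightarrow> u $ i = (\<Sum>l\<in>{\<rho>..<r}. x l * g l) \<and>
      (\<forall>l. g l \<in> A \<inter> homog (d - 1 + \<kappa> i))"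
  proof
    fix i
    show "\<exists>g. i < Q \<longrightarrow> u $ i = (\<Sum>l\<in>{\<rho>..<r}. x l * g l) \<and>
      (\<forall>l. g l \<in> A \<inter> homog (d - 1 + \<kappa> i))"
    proof (cases "i < Q")
      case True
      have shift: "d + \<kappa> i - 1 = d - 1 + \<kappa> i" by simp
      show ?thesis
        using adjoin_homog_split[OF finite_atLeastLessThan linear_forms _ free_deg_D(5)[OF ud True]
            minimal[OF u True]] free_deg_D(4)[OF ud True]
        unfolding A shift by simp
    qed simp
  qed
  from choice[OF this] obtain g where
    g: "\<forall>i. i < Q \<longrightarrow> u $ i = (\<Sum>l\<in>{\<rho>..<r}. x l * g i l) \<and>
      (\<forall>l. g i l \<in> A \<inter> homog (d - 1 + \<kappa> i))" ..
  define w where "w l = vec Q (\<lambda>i. g i l)" for l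
  have "w l \<in> free_deg A Q \<kappa> (d - 1)" for l
    using g by (simp add: w_def free_deg_def free_mod_def)
  moreover have "u = vec Q (\<lambda>i. \<Sum>l\<in>{\<rho>..<r}. x l * w l $ i)"
    using g free_deg_D(2)[OF ud] by (intro eq_vecI) (simp_all add: w_def)
  ultimately show ?thesis by (intro exI[of _ w] conjI allI)
qed

text \<open>
  The vectors \<open>q\<^sub>k\<close> of the introduction: at the point \<open>a\<close>, W shifts the sequence up to relations.
\<close>

definition lift_sequence :: "int \<Rightarrow> ('v \<Rightarrow> 'k) \<Rightarrow> (nat \<Rightarrow> ('v, 'k) mpoly vec) \<Rightarrow> bool" where
  "lift_sequence d a q \<longleftrightarrow> (\<forall>k. q k \<in> free_deg A Q \<kappa> (d - 1) \<and>
     (\<exists>h\<in>Rel d. \<forall>i<Q. eval_mpoly a ((W *\<^sub>v q k) $ i) =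
        eval_mpoly a (q (Suc k) $ i) + eval_mpoly a (h $ i)))"

lemma lift_sequence_exists:
  assumes u: "u \<in> Rel d"
  shows "\<exists>q. lift_sequence d a q \<and> (\<forall>i<Q. eval_mpoly a (q 0 $ i) = eval_mpoly a (u $ i))"
proof -
  let ?I = "{\<rho>..<r}"
  obtain w where w: "\<forall>l. w l \<in> free_deg A Q \<kappa> (d - 1)"
    and uw: "u = vec Q (\<lambda>i. \<Sum>l\<in>?I. x l * w l $ i)"
    using relation_split[OF u] by blast
  have xA: "x l \<in> A" if "l \<in> ?I" for l using that by (simp add: A adjoin.gen)
  have cA: "Const c \<in> A" for c by (simp add: A adjoin.const)
  \<comment> \<open>The direction of the deformation depends on the point.\<close>
  define \<tau> where "\<tau> l = eval_mpoly a (x l)" for l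
  have "(\<Sum>l\<in>?I. scale (x l) (\<pi> (w l))) = \<pi> u"
    unfolding uw using xA w free_deg_D(3) by (intro hom_vec_sum(2)[symmetric]) auto
  then have "(\<Sum>l\<in>?I. scale (x l) (\<pi> (w l))) = 0" using u by (simp add: Rel)
  moreover have "\<forall>l. \<pi> (w l) \<in> gr (d - 1)"
    using w hom by (simp add: module_hom_from_free_def)
  ultimately have "\<exists>F. F 0 = (\<lambda>l. \<pi> (w l)) \<and> (\<forall>k l. F k l \<in> gr (d - 1)) \<and>
       (\<forall>k. (\<Sum>l\<in>?I. scale (x l) (F (Suc k) l)) =
          scale (base_form \<rho> x s) (\<Sum>l\<in>?I. kscale (\<tau> l) (F k l)))"
    using lifts[of "d - 1"] unfolding lifts_relations_def by simp
  then obtain F where F0: "F 0 = (\<lambda>l. \<pi> (w l))" and Fgr: "\<And>k l. F k l \<in> gr (d - 1)"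
    and FS: "\<And>k. (\<Sum>l\<in>?I. scale (x l) (F (Suc k) l)) =
          scale (base_form \<rho> x s) (\<Sum>l\<in>?I. kscale (\<tau> l) (F k l))"
    by blast
  have "\<forall>kl. \<exists>v. v \<in> free_deg A Q \<kappa> (d - 1) \<and> \<pi> v = F (fst kl) (snd kl)"
    using hom_surj_deg[OF Fgr] by blast
  from choice[OF this] obtain z' where
    z': "\<forall>kl. z' kl \<in> free_deg A Q \<kappa> (d - 1) \<and> \<pi> (z' kl) = F (fst kl) (snd kl)" ..
  \<comment> \<open>For \<open>k = 0\<close> the preimages must be the given vectors, as the sequence has to start at \<open>u\<close>.\<close>
  define z where "z k l = (if k = 0 then w l else z' (k, l))" for k l
  have z: "z k l \<in> free_deg A Q \<kappa> (d - 1)" "\<pi> (z k l) = F k l" for k l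
    using w z' F0 by (auto simp: z_def)
  note zm = free_deg_D(3)[OF z(1)]
  define q where "q k = vec Q (\<lambda>i. \<Sum>l\<in>?I. Const (\<tau> l) * z k l $ i)" for k
  define t where "t k = vec Q (\<lambda>i. \<Sum>l\<in>?I. x l * z k l $ i)" for k
  have q: "q k \<in> free_mod A Q" "\<pi> (q k) = (\<Sum>l\<in>?I. kscale (\<tau> l) (F k l))" for k
    unfolding q_def using hom_vec_sum[of ?I "\<lambda>l. Const (\<tau> l)" "z k", OF cA zm]
    by (simp_all add: z(2))
  have t: "t k \<in> free_mod A Q" "\<pi> (t k) = (\<Sum>l\<in>?I. scale (x l) (F k l))" for k
    unfolding t_def using hom_vec_sum[of ?I x "z k", OF xA zm] by (simp_all add: z(2))
  have homog_mult': "f * g \<in> homog (e + c)" if "f \<in> homog e'" "g \<in> homog c'" "e' + c' = e + c"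
    for f g :: "('v, 'k) mpoly" and e c e' c' :: int
    using homog_mult[OF that(1,2)] that(3) by simp
  have qd: "q k \<in> free_deg A Q \<kappa> (d - 1)" for k
    using q(1) free_deg_D(5)[OF z(1)]
    by (auto simp: free_deg_def q_def intro!: homog_sum homog_mult'[OF Const_homog])
  have td: "t k \<in> free_deg A Q \<kappa> d" for k
    using t(1) free_deg_D(5)[OF z(1)] linear_forms
    by (auto simp: free_deg_def t_def intro!: homog_sum homog_mult'[of _ 1])
  have eval_tq: "eval_mpoly a (t k $ i) = eval_mpoly a (q k $ i)" if "i < Q" for k i
    using that by (simp add: t_def q_def \<tau>_def)
  define h where "h k = vec Q (\<lambda>i. (W *\<^sub>v q k) $ i - t (Suc k) $ i)" for k
  have "h k \<in> Rel d" for k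
  proof -
    have Wq: "W *\<^sub>v q k \<in> free_deg A Q \<kappa> d" by (rule W_degree[OF qd])
    \<comment> \<open>The difference as a sum over a two-element index set, to which \<open>hom_vec_sum\<close> applies.\<close>
    let ?v = "\<lambda>b. if b then W *\<^sub>v q k else t (Suc k)"
    let ?c = "\<lambda>b. if b then 1 else (-1 :: ('v, 'k) mpoly)"
    have hk: "h k = vec Q (\<lambda>i. \<Sum>b\<in>UNIV. ?c b * ?v b $ i)"
      unfolding h_def by (intro eq_vecI) (simp_all add: UNIV_bool)
    have c: "?c b \<in> A" for b
      using cA[of "-1"] cA[of 1] by (simp add: Const_uminus)
    have v: "?v b \<in> free_mod A Q" for b using free_deg_D(3)[OF Wq] t(1) by simp
    have "\<pi> (h k) = \<pi> (W *\<^sub>v q k) - \<pi> (t (Suc k))"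
      unfolding hk hom_vec_sum(2)[of UNIV ?c ?v, OF c v] by (simp add: UNIV_bool)
    also have "\<dots> = 0" using W_mult[OF q(1)] q(2) t(2) FS by simp
    finally have "\<pi> (h k) = 0" .
    moreover have "h k \<in> free_mod A Q" unfolding hk by (rule hom_vec_sum(1)[OF c v])
    moreover have "h k $ i \<in> homog (d + \<kappa> i)" if "i < Q" for i
    proof -
      have "- t (Suc k) $ i \<in> homog (d + \<kappa> i)"
        using free_deg_D(5)[OF td that, of "Suc k"] by (simp add: homog_iff)
      then have "(W *\<^sub>v q k) $ i + - t (Suc k) $ i \<in> homog (d + \<kappa> i)"
        by (intro homog_add free_deg_D(5)[OF Wq that])
      then show ?thesis using that by (simp add: h_def)
    qed
    ultimately show ?thesis by (simp add: Rel free_deg_def)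
  qed
  moreover have "eval_mpoly a ((W *\<^sub>v q k) $ i) = eval_mpoly a (q (Suc k) $ i) + eval_mpoly a (h k $ i)"
    if "i < Q" for k i
  proof -
    have "(W *\<^sub>v q k) $ i = t (Suc k) $ i + h k $ i" using that by (simp add: h_def)
    then show ?thesis using eval_tq[OF that] by simp
  qed
  ultimately have "lift_sequence d a q"
    unfolding lift_sequence_def using qd by (intro allI conjI bexI[of _ "h _"]) auto
  moreover have "eval_mpoly a (q 0 $ i) = eval_mpoly a (u $ i)" if "i < Q" for i
    using eval_tq[OF that, of 0] that by (simp add: uw t_def z_def)
  ultimately show ?thesis by blast
qed

lemma eval_mult_mat_vec:
  assumes "B \<in> carrier_mat Q Q" "dim_vec v = Q" "i < Q"
  shows "eval_mpoly a ((B *\<^sub>v v) $ i) = (\<Sum>j<Q. eval_mpoly a (B $$ (i, j)) * eval_mpoly a (v $ j))"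
  using assms by (simp add: scalar_prod_def atLeast0LessThan)

lemma pow_Suc_mult_vec:
  assumes "v \<in> carrier_vec Q"
  shows "(W ^\<^sub>m Suc n) *\<^sub>v v = (W ^\<^sub>m n) *\<^sub>v (W *\<^sub>v v)"
  using assoc_mult_mat_vec[OF pow_carrier_mat[OF W_carrier] W_carrier assms] by simp

text \<open>
  Relations and members of lift sequences have to be treated together: the power \<open>n + 1\<close> of W at \<open>q\<^sub>k\<close>
  is the power \<open>n\<close> at \<open>q\<^sub>k\<^sub>+\<^sub>1\<close> plus the power \<open>n\<close> at a relation, and a relation has the same value as
  the first member of a lift sequence.
\<close>

lemma eval_pow_first_zero:
  assumes d: "d \<le> - \<kappa> (p - 1)"
  shows "(\<forall>u\<in>Rel d. \<forall>i<p. eval_mpoly a (((W ^\<^sub>m n) *\<^sub>v u) $ i) = 0) \<and>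
    (\<forall>q. lift_sequence d a q \<longrightarrow> (\<forall>k. \<forall>i<p. eval_mpoly a (((W ^\<^sub>m n) *\<^sub>v q k) $ i) = 0))"
proof (induction n)
  case 0
  have one: "(W ^\<^sub>m 0) *\<^sub>v v = v" if "v \<in> carrier_vec Q" for v
    using that W_carrier by simp
  show ?case
  proof (intro conjI ballI allI impI)
    fix u i assume u: "u \<in> Rel d" and i: "i < p"
    have "u \<in> free_deg A Q \<kappa> d" using u by (simp add: Rel)
    then show "eval_mpoly a (((W ^\<^sub>m 0) *\<^sub>v u) $ i) = 0"
      using low_relation_first_zero[OF u d i] one[OF free_deg_D(1)] by simp
  next
    fix q k i assume "lift_sequence d a q" and i: "i < p"
    then have q: "q k \<in> free_deg A Q \<kappa> (d - 1)" by (simp add: lift_sequence_def)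
    then show "eval_mpoly a (((W ^\<^sub>m 0) *\<^sub>v q k) $ i) = 0"
      using lower_degree_first_zero[OF q d i] one[OF free_deg_D(1)] by simp
  qed
next
  case (Suc n)
  have Wn: "W ^\<^sub>m n \<in> carrier_mat Q Q" "W ^\<^sub>m Suc n \<in> carrier_mat Q Q"
    using W_carrier by (auto intro: pow_carrier_mat)
  have seq: "eval_mpoly a (((W ^\<^sub>m Suc n) *\<^sub>v q k) $ i) = 0"
    if q: "lift_sequence d a q" and i: "i < p" for q k i
  proof -
    have iQ: "i < Q" using i p_le by simp
    have qk: "q k \<in> free_deg A Q \<kappa> (d - 1)" "q (Suc k) \<in> free_deg A Q \<kappa> (d - 1)"
      using q by (simp_all add: lift_sequence_def)
    obtain h where h: "h \<in> Rel d" "\<forall>i<Q. eval_mpoly a ((W *\<^sub>v q k) $ i) =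
        eval_mpoly a (q (Suc k) $ i) + eval_mpoly a (h $ i)"
      using q unfolding lift_sequence_def by blast
    have hd: "dim_vec h = Q" using h(1) by (auto simp: Rel intro: free_deg_D(2))
    have "eval_mpoly a (((W ^\<^sub>m Suc n) *\<^sub>v q k) $ i) =
        (\<Sum>j<Q. eval_mpoly a ((W ^\<^sub>m n) $$ (i, j)) * eval_mpoly a ((W *\<^sub>v q k) $ j))"
      unfolding pow_Suc_mult_vec[OF free_deg_D(1)[OF qk(1)]]
      using W_carrier by (intro eval_mult_mat_vec[OF Wn(1) _ iQ]) simp
    also have "\<dots> = eval_mpoly a (((W ^\<^sub>m n) *\<^sub>v q (Suc k)) $ i) + eval_mpoly a (((W ^\<^sub>m n) *\<^sub>v h) $ i)"
      unfolding eval_mult_mat_vec[OF Wn(1) hd iQ] eval_mult_mat_vec[OF Wn(1) free_deg_D(2)[OF qk(2)] iQ]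
      using h(2) by (simp add: distrib_left sum.distrib)
    also have "\<dots> = 0" using Suc.IH q h(1) i by simp
    finally show ?thesis .
  qed
  moreover have "eval_mpoly a (((W ^\<^sub>m Suc n) *\<^sub>v u) $ i) = 0" if u: "u \<in> Rel d" and i: "i < p" for u i
  proof -
    have iQ: "i < Q" using i p_le by simp
    obtain q where q: "lift_sequence d a q" "\<forall>i<Q. eval_mpoly a (q 0 $ i) = eval_mpoly a (u $ i)"
      using lift_sequence_exists[OF u] by blast
    have "dim_vec (q 0) = Q" "dim_vec u = Q"
      using q(1) u free_deg_D(2) by (auto simp: lift_sequence_def Rel)
    then have "eval_mpoly a (((W ^\<^sub>m Suc n) *\<^sub>v u) $ i) = eval_mpoly a (((W ^\<^sub>m Suc n) *\<^sub>v q 0) $ i)"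
      using q(2) by (simp add: eval_mult_mat_vec[OF Wn(2) _ iQ] del: pow_mat.simps)
    then show ?thesis using seq[OF q(1) i] by simp
  qed
  ultimately show ?case by blast
qed

lemma W_pow_free_mod: "v \<in> free_mod A Q \<Longrightarrow> (W ^\<^sub>m n) *\<^sub>v v \<in> free_mod A Q"
proof (induction n arbitrary: v)
  case 0
  then show ?case using W_carrier by (simp add: free_mod_def)
next
  case (Suc n)
  have v: "v \<in> carrier_vec Q" "\<And>i. i < Q \<Longrightarrow> v $ i \<in> A" using Suc.prems by (auto simp: free_mod_def)
  have "(W *\<^sub>v v) $ i = (\<Sum>j<Q. W $$ (i, j) * v $ j)" if "i < Q" for i
    by (rule mult_mat_vec_entry[OF W_carrier v(1) that])
  then have "(W *\<^sub>v v) $ i \<in> A" if "i < Q" for i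
    using that W_entries[OF that] v(2) unfolding A by (auto intro!: adjoin_sum adjoin.mult)
  then have "W *\<^sub>v v \<in> free_mod A Q"
    using mult_mat_vec_carrier[OF W_carrier v(1)] unfolding free_mod_def by blast
  then show ?case using Suc.IH pow_Suc_mult_vec[OF v(1)] by simp
qed

theorem pow_relation_first_zero:
  assumes u: "u \<in> Rel d" and d: "d \<le> - \<kappa> (p - 1)"
  shows "(W ^\<^sub>m n) *\<^sub>v u \<in> first_zero A Q p"
  unfolding first_zero_def mem_Collect_eq
proof (intro conjI allI impI)
  show "(W ^\<^sub>m n) *\<^sub>v u \<in> free_mod A Q"
    using u unfolding Rel by (intro W_pow_free_mod) (blast intro: free_deg_D(3))
  fix i assume "i < p"
  then show "((W ^\<^sub>m n) *\<^sub>v u) $ i = 0"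
    using eval_pow_first_zero[OF d] u by (intro mpoly_eq_0_if_eval_0[OF infinite_field]) blast
qed

end

theorem theorem2p1:
  fixes scale :: "('v::finite, 'k::field) mpoly \<Rightarrow> 'e::ab_group_add \<Rightarrow> 'e"
    and gr :: "int \<Rightarrow> 'e set"
    and r \<rho> :: nat
    and y :: "nat \<Rightarrow> 'v"
  assumes "infinite (UNIV :: 'k set)"
    and "bij_betw y {..<r} UNIV"
    and "graded_module scale gr"
    and "finitely_generated scale"
    and "1 \<le> \<rho>" and "\<rho> < r"
  shows "\<exists>U :: 'k mat set. zariski_open_GL r U \<and> U \<noteq> {} \<and>
    (\<forall>\<Gamma>\<in>U. \<forall>x Rstar rk tw \<delta> \<pi> Q \<kappa> Q' \<kappa>' \<Phi> X p s W.
       new_coordinates r y \<Gamma> x \<longrightarrow>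
       Rstar = adjoin (x ` {\<rho>..<r}) \<longrightarrow>
       minimal_free_resolution scale gr Rstar rk tw \<delta> \<pi> \<longrightarrow>
       Q = rk 0 \<longrightarrow> \<kappa> = tw 0 \<longrightarrow> Q' = rk 1 \<longrightarrow> \<kappa>' = (\<lambda>i. - tw 1 i) \<longrightarrow> \<Phi> = \<delta> 0 \<longrightarrow>
       (\<forall>i j. i \<le> j \<and> j < Q \<longrightarrow> \<kappa> i \<le> \<kappa> j) \<longrightarrow>
       (\<forall>i j. i \<le> j \<and> j < Q' \<longrightarrow> \<kappa>' i \<le> \<kappa>' j) \<longrightarrow>
       (\<forall>j<\<rho>. X j \<in> carrier_mat Q Q \<and>
          (\<forall>a<Q. \<forall>b<Q. X j $$ (a, b) \<in> Rstar) \<and>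
          free_hom Rstar Q (\<lambda>i. \<kappa> i - 1) Q \<kappa> (\<lambda>v. X j *\<^sub>v v) \<and>
          (\<forall>v\<in>free_mod Rstar Q. \<pi> (X j *\<^sub>v v) = scale (x j) (\<pi> v))) \<longrightarrow>
       1 \<le> p \<longrightarrow> p < Q \<longrightarrow> \<kappa> (p - 1) < \<kappa> p \<longrightarrow>
       W = lin_comb_mat Q \<rho> X s \<longrightarrow>
       (\<forall>\<nu>. (\<lambda>v. (W ^\<^sub>m \<nu>) *\<^sub>v v) `
             part_le Rstar Q \<kappa> (\<Phi> ` free_mod Rstar Q') (- \<kappa> (p - 1))
             \<subseteq> first_zero Rstar Q p))"
proof -
  interpret graded_mpoly_module scale gr using assms(3) by unfold_locales
  let ?A = "\<lambda>x. adjoin (x ` {\<rho>..<r})"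
  show ?thesis
  proof (cases "\<exists>\<Gamma>\<in>GL r. \<exists>x rk tw \<delta> \<pi>. new_coordinates r y \<Gamma> x \<and>
      minimal_free_resolution scale gr (?A x) rk tw \<delta> \<pi>")
    case False
    \<comment> \<open>No coordinates admit a resolution of finite rank, so the claim is vacuous on all of \<open>GL r\<close>.\<close>
    have "zariski_open_GL r (GL r :: 'k mat set)"
      unfolding zariski_open_GL_def by (intro exI[of _ "{1}"]) simp
    moreover have "1\<^sub>m r \<in> (GL r :: 'k mat set)" by (simp add: GL_iff_det)
    ultimately show ?thesis
      using False by (intro exI[of _ "GL r"] conjI ballI allI impI) auto
  next
    case True
    then obtain \<Gamma>0 x0 rk0 tw0 \<delta>0 \<pi>0 where \<Gamma>0: "\<Gamma>0 \<in> GL r" "new_coordinates r y \<Gamma>0 x0"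
      and res: "minimal_free_resolution scale gr (?A x0) rk0 tw0 \<delta>0 \<pi>0" by blast
    have "generated_by (?A x0) (rk0 0) (tw0 0) (\<lambda>i. \<pi>0 (unit_vec (rk0 0) i))"
      using res unfolding minimal_free_resolution_def by (intro hom_from_free_generates) auto
    from generic_coordinates_lift_relations[OF assms(1) \<Gamma>0 assms(5) less_imp_le[OF assms(6)] this]
    obtain U where U: "zariski_open_GL r U" "U \<noteq> {}"
      and lifts: "\<forall>\<Gamma>\<in>U. \<forall>x. new_coordinates r y \<Gamma> x \<longrightarrow> (\<forall>d. lifts_relations \<rho> r x d)"
      by blast
    show ?thesis
    proof (intro exI[of _ U] conjI U ballI allI impI)
      fix \<Gamma> x Rstar rk tw \<delta> \<pi> Q \<kappa> Q' \<kappa>' \<Phi> X p s W \<nu>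
      assume \<Gamma>: "\<Gamma> \<in> U" and x: "new_coordinates r y \<Gamma> x" and Rstar: "Rstar = ?A x"
        and res: "minimal_free_resolution scale gr Rstar rk tw \<delta> \<pi>"
        and eqs: "Q = rk 0" "\<kappa> = tw 0" "Q' = rk 1" "\<kappa>' = (\<lambda>i. - tw 1 i)" "\<Phi> = \<delta> 0"
        and mono: "\<forall>i j. i \<le> j \<and> j < Q \<longrightarrow> \<kappa> i \<le> \<kappa> j"
        and X: "\<forall>j<\<rho>. X j \<in> carrier_mat Q Q \<and>
          (\<forall>a<Q. \<forall>b<Q. X j $$ (a, b) \<in> Rstar) \<and>
          free_hom Rstar Q (\<lambda>i. \<kappa> i - 1) Q \<kappa> (\<lambda>v. X j *\<^sub>v v) \<and>
          (\<forall>v\<in>free_mod Rstar Q. \<pi> (X j *\<^sub>v v) = scale (x j) (\<pi> v))"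
        and p: "1 \<le> p" "p < Q" and W: "W = lin_comb_mat Q \<rho> X s"
      define Rel where "Rel d = {u \<in> free_deg Rstar Q \<kappa> d. \<pi> u = 0}" for d
      have hom: "module_hom_from_free scale gr Rstar Q \<kappa> \<pi>" and surj: "\<pi> ` free_mod Rstar Q = UNIV"
        and ker: "{u \<in> free_mod Rstar Q. \<pi> u = 0} = \<Phi> ` free_mod Rstar Q'"
        and min: "\<And>u i. u \<in> free_mod Rstar Q' \<Longrightarrow> i < Q \<Longrightarrow> Poly_Mapping.lookup (\<Phi> u $ i) 0 = 0"
        using res unfolding minimal_free_resolution_def eqs by auto
      have Wc: "W \<in> carrier_mat Q Q" by (simp add: W lin_comb_mat_def)
      \<comment> \<open>With coefficient 1 at index 0, W and \<open>base_form\<close> become sums over all indices below \<open>\<rho>\<close>.\<close>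
      define \<sigma> where "\<sigma> = s(0 := 1)"
      have set: "{..<\<rho>} = insert 0 {1..<\<rho>}" using assms(5) by auto
      have W_entry: "W $$ (a, b) = (\<Sum>j<\<rho>. Const (\<sigma> j) * X j $$ (a, b))" if "a < Q" "b < Q" for a b
        using that unfolding set by (simp add: W lin_comb_mat_def \<sigma>_def)
      have bf: "base_form \<rho> x s = (\<Sum>j<\<rho>. Const (\<sigma> j) * x j)"
        unfolding \<sigma>_def by (rule base_form_sum[OF assms(5)])
      have W_vec: "W *\<^sub>v v = vec Q (\<lambda>i. \<Sum>j<\<rho>. Const (\<sigma> j) * (X j *\<^sub>v v) $ i)" if v: "v \<in> carrier_vec Q" for v
      proof (rule eq_vecI)
        fix i assume "i < dim_vec (vec Q (\<lambda>i. \<Sum>j<\<rho>. Const (\<sigma> j) * (X j *\<^sub>v v) $ i))"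
        then have i: "i < Q" by simp
        have "(W *\<^sub>v v) $ i = (\<Sum>b<Q. W $$ (i, b) * v $ b)"
          by (rule mult_mat_vec_entry[OF Wc v i])
        also have "\<dots> = (\<Sum>b<Q. \<Sum>j<\<rho>. Const (\<sigma> j) * (X j $$ (i, b) * v $ b))"
          using i by (simp add: W_entry sum_distrib_right mult.assoc)
        also have "\<dots> = (\<Sum>j<\<rho>. Const (\<sigma> j) * (\<Sum>b<Q. X j $$ (i, b) * v $ b))"
          by (subst sum.swap) (simp add: sum_distrib_left)
        also have "\<dots> = (\<Sum>j<\<rho>. Const (\<sigma> j) * (X j *\<^sub>v v) $ i)"
          using i v X by (intro sum.cong) (auto simp: scalar_prod_def atLeast0LessThan)
        finally show "(W *\<^sub>v v) $ i = vec Q (\<lambda>i. \<Sum>j<\<rho>. Const (\<sigma> j) * (X j *\<^sub>v v) $ i) $ i"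
          using i by simp
      qed (use Wc in simp)
      have X_mod: "X j *\<^sub>v v \<in> free_mod Rstar Q" if "j < \<rho>" "v \<in> free_mod Rstar Q" for j v
        using X that by (simp add: free_hom_def)
      have X_deg: "X j *\<^sub>v v \<in> free_deg Rstar Q \<kappa> d" if "j < \<rho>" "v \<in> free_deg Rstar Q \<kappa> (d - 1)" for j v d
      proof -
        have "v \<in> free_deg Rstar Q (\<lambda>i. \<kappa> i - 1) d"
          using that(2) by (simp add: free_deg_def algebra_simps)
        then show ?thesis using X that(1) by (simp add: free_hom_def)
      qed
      have comb: "\<pi> v = (\<Sum>i<Q. scale (v $ i) (\<pi> (unit_vec Q i)))" if "v \<in> free_mod Rstar Q" for v
        using hom_from_free_combination hom that unfolding Rstar by blast
      have W_mod: "W *\<^sub>v v \<in> free_mod Rstar Q" if v: "v \<in> free_mod Rstar Q" for v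
      proof -
        have vc: "v \<in> carrier_vec Q" using v by (simp add: free_mod_def)
        show ?thesis
          using X_mod[OF _ v] unfolding W_vec[OF vc] Rstar free_mod_def
          by (auto intro!: adjoin_sum adjoin.mult adjoin.const)
      qed
      interpret relations_in_generic_coordinates scale gr \<rho> r Q p x \<kappa> \<pi> W s Rstar Rel
      proof unfold_locales
        show "infinite (UNIV :: 'k set)" by fact
        show "Rstar = adjoin (x ` {\<rho>..<r})" by fact
        show "x ` {\<rho>..<r} \<subseteq> homog 1" using x by (auto simp: new_coordinates_def)
        show "module_hom_from_free scale gr Rstar Q \<kappa> \<pi>" by fact
        show "\<pi> ` free_mod Rstar Q = UNIV" by fact
        show "Rel d = {u \<in> free_deg Rstar Q \<kappa> d. \<pi> u = 0}" for d by (rule Rel_def)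
        show "Poly_Mapping.lookup (u $ i) 0 = 0" if "u \<in> Rel d" "i < Q" for u d i
        proof -
          have "u \<in> \<Phi> ` free_mod Rstar Q'"
            using that(1) unfolding ker[symmetric] Rel_def free_deg_def by simp
          then show ?thesis using min that(2) by blast
        qed
        show "W \<in> carrier_mat Q Q" by fact
        show "W $$ (i, j) \<in> Rstar" if "i < Q" "j < Q" for i j
          using X that unfolding W_entry[OF that] Rstar
          by (auto intro!: adjoin_sum adjoin.mult adjoin.const)
        show "W *\<^sub>v v \<in> free_deg Rstar Q \<kappa> d" if v: "v \<in> free_deg Rstar Q \<kappa> (d - 1)" for v d
        proof -
          have vm: "v \<in> free_mod Rstar Q" using v by (simp add: free_deg_def)
          then have vc: "v \<in> carrier_vec Q" by (simp add: free_mod_def)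
          have "(\<Sum>j<\<rho>. Const (\<sigma> j) * (X j *\<^sub>v v) $ i) \<in> homog (d + \<kappa> i)" if i: "i < Q" for i
          proof (rule homog_sum)
            fix j assume "j \<in> {..<\<rho>}"
            then have "(X j *\<^sub>v v) $ i \<in> homog (d + \<kappa> i)"
              using X_deg[OF _ v] i unfolding free_deg_def by blast
            then show "Const (\<sigma> j) * (X j *\<^sub>v v) $ i \<in> homog (d + \<kappa> i)"
              using homog_mult[OF Const_homog] by fastforce
          qed
          then show ?thesis
            using W_mod[OF vm] unfolding free_deg_def mem_Collect_eq W_vec[OF vc] by simp
        qed
        show "\<pi> (W *\<^sub>v v) = scale (base_form \<rho> x s) (\<pi> v)" if v: "v \<in> free_mod Rstar Q" for v
        proof -
          have vc: "v \<in> carrier_vec Q" using v by (simp add: free_mod_def)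
          have "\<pi> (W *\<^sub>v v) = (\<Sum>i<Q. scale (\<Sum>j<\<rho>. Const (\<sigma> j) * (X j *\<^sub>v v) $ i) (\<pi> (unit_vec Q i)))"
            unfolding comb[OF W_mod[OF v]] by (simp add: W_vec[OF vc])
          also have "\<dots> = (\<Sum>j<\<rho>. kscale (\<sigma> j) (\<Sum>i<Q. scale ((X j *\<^sub>v v) $ i) (\<pi> (unit_vec Q i))))"
            by (simp add: M.scale_sum_left M.scale_sum_right sum.swap[of _ "{..<Q}"])
          also have "\<dots> = (\<Sum>j<\<rho>. kscale (\<sigma> j) (scale (x j) (\<pi> v)))"
            using X v by (intro sum.cong refl) (simp add: comb[OF X_mod[OF _ v], symmetric])
          also have "\<dots> = scale (base_form \<rho> x s) (\<pi> v)"
            unfolding bf by (simp add: M.scale_sum_left)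
          finally show ?thesis .
        qed
        show "lifts_relations \<rho> r x d" for d using lifts \<Gamma> x by blast
        show "\<kappa> i \<le> \<kappa> (p - 1)" if "i < p" for i
        proof -
          have "i \<le> p - 1" "p - 1 < Q" using that p by auto
          then show ?thesis using mono by blast
        qed
        show "p \<le> Q" using p by simp
      qed
      show "(\<lambda>v. (W ^\<^sub>m \<nu>) *\<^sub>v v) ` part_le Rstar Q \<kappa> (\<Phi> ` free_mod Rstar Q') (- \<kappa> (p - 1))
             \<subseteq> first_zero Rstar Q p"
      proof (rule image_subsetI)
        fix v assume "v \<in> part_le Rstar Q \<kappa> (\<Phi> ` free_mod Rstar Q') (- \<kappa> (p - 1))"
        then obtain c D where v: "v = finsum_vec TYPE(('v, 'k) mpoly) Q c D" and D: "finite D"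
          "D \<subseteq> {..- \<kappa> (p - 1)}" and c: "\<forall>d\<in>D. c d \<in> \<Phi> ` free_mod Rstar Q' \<inter> free_deg Rstar Q \<kappa> d"
          unfolding part_le_def by blast
        have cRel: "c d \<in> Rel d" if "d \<in> D" for d
          using c that unfolding ker[symmetric] Rel_def by blast
        have Wc': "(W ^\<^sub>m \<nu>) *\<^sub>v c d \<in> first_zero Rstar Q p" if "d \<in> D" for d
          using D(2) that by (intro pow_relation_first_zero[OF cRel[OF that]]) auto
        have cc: "c d \<in> carrier_vec Q" if "d \<in> D" for d
          using cRel[OF that] free_deg_D(1) by (auto simp: Rel_def)
        have vc: "v \<in> carrier_vec Q" unfolding v using cc by (intro finsum_vec_closed) auto
        have Wn: "W ^\<^sub>m \<nu> \<in> carrier_mat Q Q" by (rule pow_carrier_mat[OF Wc])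
        have entry: "((W ^\<^sub>m \<nu>) *\<^sub>v v) $ i = (\<Sum>d\<in>D. ((W ^\<^sub>m \<nu>) *\<^sub>v c d) $ i)" if i: "i < Q" for i
        proof -
          have expand: "((W ^\<^sub>m \<nu>) *\<^sub>v u) $ i = (\<Sum>b<Q. (W ^\<^sub>m \<nu>) $$ (i, b) * u $ b)"
            if "u \<in> carrier_vec Q" for u
            by (rule mult_mat_vec_entry[OF Wn that i])
          have "v $ b = (\<Sum>d\<in>D. c d $ b)" if "b < Q" for b
            unfolding v using cc by (intro index_finsum_vec[OF D(1) that]) auto
          then have "((W ^\<^sub>m \<nu>) *\<^sub>v v) $ i = (\<Sum>b<Q. \<Sum>d\<in>D. (W ^\<^sub>m \<nu>) $$ (i, b) * c d $ b)"
            unfolding expand[OF vc] by (simp add: sum_distrib_left)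
          also have "\<dots> = (\<Sum>d\<in>D. ((W ^\<^sub>m \<nu>) *\<^sub>v c d) $ i)"
            by (subst sum.swap) (simp add: expand cc)
          finally show ?thesis .
        qed
        show "(W ^\<^sub>m \<nu>) *\<^sub>v v \<in> first_zero Rstar Q p"
          unfolding first_zero_def free_mod_def mem_Collect_eq
        proof (intro conjI allI impI)
          show "(W ^\<^sub>m \<nu>) *\<^sub>v v \<in> carrier_vec Q" by (rule mult_mat_vec_carrier[OF Wn vc])
          show "((W ^\<^sub>m \<nu>) *\<^sub>v v) $ i \<in> Rstar" if "i < Q" for i
            using Wc' that unfolding entry[OF that] Rstar first_zero_def free_mod_def
            by (auto intro!: adjoin_sum)
          show "((W ^\<^sub>m \<nu>) *\<^sub>v v) $ i = 0" if "i < p" for i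
            using Wc' that p entry[of i] by (auto simp: first_zero_def intro!: sum.neutral)
        qed
      qed
    qed
  qed
qed

end
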